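(* Let $\mathbf{X}:\Omega\to\mathbb{R}^M$ be a random vector with finite differential entropy, zero mean and covariance $\operatorname{diag}(\lambda_1,\dots,\lambda_M)$ with $\lambda_i>0$. Let $\mathbf{U}\sim\mathcal{N}(0,\mathbf{I})$ be independent of $\mathbf{X}$, fix $\theta>0$, set $\gamma_i^2=\min(1,\theta/\lambda_i)$ and define $$Z_i=\sqrt{1-\gamma_i^2}\,X_i+\gamma_i\sqrt{\lambda_i}\,U_i,\quad i=1,\dots,M,$$ and let $\hat{\mathbf{X}}$ be drawn from the conditional distribution $P(\mathbf{X}\mid\mathbf{Z})$ (i.e. $\hat{\mathbf{X}}$ is conditionally independent of $\mathbf{X}$ given $\mathbf{Z}$ and $(\hat{\mathbf{X}},\mathbf{Z})$ has the same joint distribution as $(\mathbf{X},\mathbf{Z})$). Let $\mathbf{X}^*$ be a Gaussian random vector with the same mean and covariance as $\mathbf{X}$, and let $\mathbf{Z}^*$ be defined as $\mathbf{Z}$ but with $\mathbf{X}^*$ in place of $\mathbf{X}$ (with noise independent of $\mathbf{X}^*$). Let $R$ and $R^*$ be the rate-distortion functions of $\mathbf{X}$ and $\mathbf{X}^*$, respectively, and let $D=\mathbb{E}[\|\mathbf{X}-\hat{\mathbf{X}}\|^2]$. Then $$I[\mathbf{X},\mathbf{Z}]\le R^*(D/2)-D_{\mathrm{KL}}(P_{\mathbf{Z}}\,\|\,P_{\mathbf{Z}^*})\le R(D/2)+D_{\mathrm{KL}}(P_{\mathbf{X}}\,\|\,P_{\mathbf{X}^*})-D_{\mathrm{KL}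}(P_{\mathbf{Z}}\,\|\,P_{\mathbf{Z}^*}).$$
   Context: All logarithms (in mutual information, KL divergence and rates) are to base 2. For a random vector $\mathbf{X}$ in $\mathbb{R}^M$, its (information) rate-distortion function under squared error is $R(D)=\inf I[\mathbf{X},\hat{\mathbf{X}}]$, the infimum over all conditional distributions of $\hat{\mathbf{X}}$ given $\mathbf{X}$ such that $\mathbb{E}[\|\mathbf{X}-\hat{\mathbf{X}}\|^2]\le D$. $P_{\mathbf{Y}}$ denotes the distribution of a random vector $\mathbf{Y}$. *)

theory Defs
  imports "HOL-Analysis.Analysis" "HOL-Probability.Probability"
begin

text \<open>Kullback-Leibler divergence D(P || Q) (extended real valued; infinite when P is
  not absolutely continuous w.r.t. Q).  It is the integral of log2 (dP/dQ) w.r.t. P,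
  split into positive and negative parts (the negative part is always finite for
  probability measures).\<close>
definition KL2 :: "'a measure \<Rightarrow> 'a measure \<Rightarrow> ereal" where
  "KL2 P Q =
    (if sets P = sets Q \<and> absolutely_continuous Q P then
       enn2ereal (\<integral>\<^sup>+ x. ennreal (log 2 (enn2real (RN_deriv Q P x))) \<partial>P)
       - enn2ereal (\<integral>\<^sup>+ x. ennreal (- log 2 (enn2real (RN_deriv Q P x))) \<partial>P)
     else \<infinity>)"

definition MI_joint :: "('a \<times> 'b) measure \<Rightarrow> 'a measure \<Rightarrow> 'b measure \<Rightarrow> ereal" where
  "MI_joint J S T = KL2 J (distr J S fst \<Otimes>\<^sub>M distr J T snd)"

definition MI :: "'w measure \<Rightarrow> ('w \<Rightarrow> 'a::topological_space) \<Rightarrow> ('w \<Rightarrow> 'b::topological_space) \<Rightarrow> ereal" where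
  "MI \<Omega> X Y = KL2 (distr \<Omega> (borel \<Otimes>\<^sub>M borel) (\<lambda>\<omega>. (X \<omega>, Y \<omega>)))
                   (distr \<Omega> borel X \<Otimes>\<^sub>M distr \<Omega> borel Y)"

definition joint_kernel :: "('a::topological_space) measure \<Rightarrow> ('a \<Rightarrow> ('b::topological_space) measure) \<Rightarrow> ('a \<times> 'b) measure" where
  "joint_kernel P K = P \<bind> (\<lambda>x. distr (K x) (borel \<Otimes>\<^sub>M borel) (\<lambda>y. (x, y)))"

definition rate_distortion :: "('a::euclidean_space) measure \<Rightarrow> real \<Rightarrow> ereal" where
  "rate_distortion P D =
    (INF K \<in> {K. K \<in> borel \<rightarrow>\<^sub>M prob_algebra (borel :: 'a measure) \<and>
                 (\<integral>\<^sup>+ z. ennreal ((norm (fst z - snd z))\<^sup>2) \<partial>(joint_kernel P K)) \<le> ennreal D}.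
        MI_joint (joint_kernel P K) borel borel)"

definition mean_vec :: "'w measure \<Rightarrow> ('w \<Rightarrow> real ^ 'm) \<Rightarrow> real ^ 'm" where
  "mean_vec \<Omega> X = (\<integral>\<omega>. X \<omega> \<partial>\<Omega>)"

definition cov_matrix :: "'w measure \<Rightarrow> ('w \<Rightarrow> real ^ 'm) \<Rightarrow> real ^ 'm ^ 'm" where
  "cov_matrix \<Omega> X = (\<chi> i j. \<integral>\<omega>. (X \<omega> $ i - mean_vec \<Omega> X $ i) * (X \<omega> $ j - mean_vec \<Omega> X $ j) \<partial>\<Omega>)"

definition mvn_density :: "real ^ 'm \<Rightarrow> real ^ 'm ^ 'm \<Rightarrow> real ^ 'm \<Rightarrow> real" where
  "mvn_density \<mu> \<Sigma> x =
     1 / sqrt ((2 * pi) ^ CARD('m) * det \<Sigma>) *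
     exp (- ((x - \<mu>) \<bullet> (matrix_inv \<Sigma> *v (x - \<mu>))) / 2)"

definition gaussian_measure :: "real ^ 'm \<Rightarrow> real ^ 'm ^ 'm \<Rightarrow> (real ^ 'm) measure" where
  "gaussian_measure \<mu> \<Sigma> = density lborel (\<lambda>x. ennreal (mvn_density \<mu> \<Sigma> x))"

definition finite_diff_entropy :: "'w measure \<Rightarrow> ('w \<Rightarrow> real ^ 'm) \<Rightarrow> bool" where
  "finite_diff_entropy \<Omega> X \<longleftrightarrow>
     (\<exists>p. distributed \<Omega> lborel X p \<and>
          integrable lborel (\<lambda>x. enn2real (p x) * log 2 (enn2real (p x))))"

definition cond_indep :: "'w measure \<Rightarrow> ('w \<Rightarrow> 'c::topological_space) \<Rightarrow> ('w \<Rightarrow> 'a::topological_space) \<Rightarrow> ('w \<Rightarrow> 'b::topological_space) \<Rightarrow> bool" where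
  "cond_indep \<Omega> Z X Y \<longleftrightarrow>
     (\<forall>A \<in> sets borel. \<forall>B \<in> sets borel.
        AE \<omega> in \<Omega>.
          real_cond_exp \<Omega> (vimage_algebra (space \<Omega>) Z borel)
              (indicator {v \<in> space \<Omega>. X v \<in> A \<and> Y v \<in> B}) \<omega>
          = real_cond_exp \<Omega> (vimage_algebra (space \<Omega>) Z borel) (indicator {v \<in> space \<Omega>. X v \<in> A}) \<omega>
            * real_cond_exp \<Omega> (vimage_algebra (space \<Omega>) Z borel) (indicator {v \<in> space \<Omega>. Y v \<in> B}) \<omega>)"

end

theory Submission
  imports Defs
begin

text \<open>
  Write \<open>s\<^sub>i = min \<lambda>\<^sub>i \<theta>\<close> and \<open>C(\<theta>) = \<Sum>\<^sub>i log (\<lambda>\<^sub>i / s\<^sub>i) / 2\<close>. Given \<open>X\<close>, the vector \<open>Z\<close> is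
  Gaussian with coordinate variances \<open>s\<^sub>i\<close>, and \<open>Z\<close> and \<open>Z\<^sup>*\<close> have the same second moments, so
  \<open>I[X, Z] + KL(P\<^sub>Z || P\<^sub>Z\<^sub>*) = C(\<theta>)\<close>, with both summands finite. As \<open>Xh\<close> is a conditionally independent
  copy of \<open>X\<close> given \<open>Z\<close>, \<open>D / 2\<close> is the minimal mean square error of estimating \<open>X\<close> from \<open>Z\<close>, which is at
  most the linear one, \<open>\<Sum>\<^sub>i s\<^sub>i\<close>.

  Both inequalities then reduce to reverse water-filling. The Donsker--Varadhan bound with the
  Gaussian dual function shows \<open>C(\<theta>) \<le> R\<^sub>P(\<Delta>) + KL(P || P\<^sub>X\<^sub>*)\<close> for every law \<open>P\<close> with second moments
  \<open>\<lambda>\<close> and every \<open>\<Delta> \<le> \<Sum>\<^sub>i min \<lambda>\<^sub>i \<theta>\<close>, because the expected dual function depends on second moments only.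
  Taking \<open>P = P\<^sub>X\<^sub>*\<close> gives the first inequality. For the second one, choose \<open>\<theta>'\<close> with
  \<open>\<Sum>\<^sub>i min \<lambda>\<^sub>i \<theta>' = D / 2\<close>, take \<open>P = P\<^sub>X\<close>, and use that \<open>C(\<theta>')\<close> is attained by the Gaussian source
  (if \<open>D = 0\<close>, letting \<open>\<theta>' \<rightarrow> 0\<close> makes the right-hand side infinite).
\<close>

section \<open>Kullback-Leibler divergence\<close>

text \<open>Moving the density under the \<open>Q\<close>-integral turns the integrand into the
  positive part of \<open>- t * log 2 t\<close>. This is at most \<open>1 / ln 2\<close>, by
  \<open>ln x \<le> x - 1\<close> at \<open>x = 1 / t\<close>, and \<open>Q\<close> is
  finite.\<close>

lemma nn_integral_neg_log_density_finite:
  fixes r :: "'a \<Rightarrow> ennreal"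
  assumes "finite_measure Q" and [measurable]: "r \<in> borel_measurable Q"
  shows "(\<integral>\<^sup>+ x. ennreal (- log 2 (enn2real (r x))) \<partial>density Q r) < \<infinity>"
proof -
  have bound: "t * ennreal (- log 2 (enn2real t)) \<le> ennreal (1 / ln 2)" for t :: ennreal
  proof (cases t)
    case (real s)
    show ?thesis
    proof (cases "s = 0")
      case False
      then have s: "s > 0" using real by simp
      have "- ln s \<le> 1 / s - 1"
        using ln_le_minus_one[of "1 / s"] s by (simp add: ln_div)
      then have "s * (- ln s) \<le> s * (1 / s - 1)" using s by (intro mult_left_mono) auto
      then have "s * (- ln s) \<le> 1" using s by (simp add: algebra_simps)
      then have "s * (- log 2 s) \<le> 1 / ln 2"
        by (simp add: log_def field_simps)
      then show ?thesis using real s by (simp add: ennreal_mult'[symmetric])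
    qed (use real in simp)
  \<comment> \<open>At \<open>t = \<infinity>\<close> the defaults
    \<open>enn2real \<infinity> = 0\<close> and \<open>ln 0 = 0\<close> make the product 0.\<close>
  qed (simp add: log_def)
  have "(\<integral>\<^sup>+ x. ennreal (- log 2 (enn2real (r x))) \<partial>density Q r)
      = (\<integral>\<^sup>+ x. r x * ennreal (- log 2 (enn2real (r x))) \<partial>Q)"
    by (subst nn_integral_density) auto
  also have "\<dots> \<le> (\<integral>\<^sup>+ x. ennreal (1 / ln 2) \<partial>Q)"
    by (intro nn_integral_mono bound)
  also have "\<dots> < \<infinity>"
    using finite_measure.emeasure_finite[OF assms(1), of "space Q"]
    by (simp add: ennreal_mult_less_top top.not_eq_extremum)
  finally show ?thesis .
qed

lemma integrable_log_densityI:
  fixes r :: "'a \<Rightarrow> ennreal"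
  assumes "finite_measure Q" and [measurable]: "r \<in> borel_measurable Q"
    and "(\<integral>\<^sup>+ x. ennreal (log 2 (enn2real (r x))) \<partial>density Q r) < \<infinity>"
  shows "integrable (density Q r) (\<lambda>x. log 2 (enn2real (r x)))"
  using assms nn_integral_neg_log_density_finite[OF assms(1,2)]
  by (subst real_integrable_def) auto

lemma enn2ereal_diff_eq_integral:
  fixes f :: "'a \<Rightarrow> real"
  assumes "integrable M f"
  shows "enn2ereal (\<integral>\<^sup>+ x. ennreal (f x) \<partial>M) - enn2ereal (\<integral>\<^sup>+ x. ennreal (- f x) \<partial>M)
    = ereal (\<integral>x. f x \<partial>M)"
proof -
  have fin: "(\<integral>\<^sup>+ x. ennreal (f x) \<partial>M) \<noteq> \<infinity>" "(\<integral>\<^sup>+ x. ennreal (- f x) \<partial>M) \<noteq> \<infinity>"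
    using assms unfolding real_integrable_def by auto
  have eq: "enn2ereal a = ereal (enn2real a)" if "a \<noteq> \<infinity>" for a
    using that by (cases a) (auto simp: enn2ereal_ennreal)
  show ?thesis
    using real_lebesgue_integral_def[OF assms] by (simp add: eq[OF fin(1)] eq[OF fin(2)])
qed

text \<open>Densities are unique almost everywhere, so \<open>RN_deriv\<close> may be replaced by
  the explicit \<open>r\<close>; integrability then merges the two halves of \<open>KL2\<close> into
  one Bochner integral. Every exact divergence below is evaluated in this way.\<close>

lemma KL2_density:
  fixes r :: "'a \<Rightarrow> real"
  assumes Q: "sigma_finite_measure Q" and r[measurable]: "r \<in> borel_measurable Q"
    and nn: "\<And>x. r x \<ge> 0"
    and int: "integrable (density Q (\<lambda>x. ennreal (r x))) (\<lambda>x. log 2 (r x))"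
  shows "KL2 (density Q (\<lambda>x. ennreal (r x))) Q
    = ereal (\<integral>x. log 2 (r x) \<partial>density Q (\<lambda>x. ennreal (r x)))"
proof -
  let ?P = "density Q (\<lambda>x. ennreal (r x))"
  interpret Q: sigma_finite_measure Q by fact
  have "AE x in Q. ennreal (r x) = RN_deriv Q ?P x"
    by (rule Q.RN_deriv_unique) auto
  then have ae: "AE x in ?P. log 2 (enn2real (RN_deriv Q ?P x)) = log 2 (r x)"
    by (subst AE_density) (auto elim!: eventually_mono simp: nn dest: sym)
  have ac: "absolutely_continuous Q ?P"
    by (intro absolutely_continuousI_density) simp
  have "KL2 ?P Q = enn2ereal (\<integral>\<^sup>+ x. ennreal (log 2 (enn2real (RN_deriv Q ?P x))) \<partial>?P)
       - enn2ereal (\<integral>\<^sup>+ x. ennreal (- log 2 (enn2real (RN_deriv Q ?P x))) \<partial>?P)"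
    using ac by (simp add: KL2_def)
  also have "(\<integral>\<^sup>+ x. ennreal (log 2 (enn2real (RN_deriv Q ?P x))) \<partial>?P)
      = (\<integral>\<^sup>+ x. ennreal (log 2 (r x)) \<partial>?P)"
    by (intro nn_integral_cong_AE) (use ae in auto)
  also have "(\<integral>\<^sup>+ x. ennreal (- log 2 (enn2real (RN_deriv Q ?P x))) \<partial>?P)
      = (\<integral>\<^sup>+ x. ennreal (- log 2 (r x)) \<partial>?P)"
    by (intro nn_integral_cong_AE) (use ae in auto)
  finally show ?thesis using enn2ereal_diff_eq_integral[OF int] by simp
qed

lemma KL2_self:
  assumes "sigma_finite_measure P"
  shows "KL2 P P = 0"
  using KL2_density[OF assms, of "\<lambda>_. 1"] by (simp add: density_1 zero_ereal_def)

text \<open>The negative part of the log-density is always finite, so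
  \<open>\<infinity> - \<infinity>\<close> cannot occur: a divergence is either infinite or a
  genuine real integral. Lower bounds for divergences then need an argument in the real case
  only.\<close>

lemma KL2_cases:
  assumes "finite_measure Q" "sets P = sets Q"
  obtains "KL2 P Q = \<infinity>"
  | "absolutely_continuous Q P"
    "integrable P (\<lambda>x. log 2 (enn2real (RN_deriv Q P x)))"
    "KL2 P Q = ereal (\<integral>x. log 2 (enn2real (RN_deriv Q P x)) \<partial>P)"
proof (cases "absolutely_continuous Q P")
  case True
  interpret Q: finite_measure Q by fact
  have P: "density Q (RN_deriv Q P) = P"
    using True assms(2) by (rule Q.density_RN_deriv)
  have neg: "(\<integral>\<^sup>+ x. ennreal (- log 2 (enn2real (RN_deriv Q P x))) \<partial>P) < \<infinity>"
    using nn_integral_neg_log_density_finite[OF assms(1), of "RN_deriv Q P"] by (simp add: P)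
  let ?A = "\<integral>\<^sup>+ x. ennreal (log 2 (enn2real (RN_deriv Q P x))) \<partial>P"
  show thesis
  proof (cases "?A = \<infinity>")
    case True2: True
    have "enn2ereal b \<noteq> \<infinity>" if "b < \<infinity>" for b
      using that by (cases b) (auto simp: enn2ereal_ennreal)
    then have "KL2 P Q = \<infinity>"
      using True assms(2) True2 neg by (simp add: KL2_def)
    then show thesis by (rule that)
  next
    case False
    then have int: "integrable P (\<lambda>x. log 2 (enn2real (RN_deriv Q P x)))"
      using integrable_log_densityI[OF assms(1), of "RN_deriv Q P"]
      by (simp add: P top.not_eq_extremum)
    then show thesis
      using that True assms(2) enn2ereal_diff_eq_integral[OF int] by (simp add: KL2_def)
  qed
next
  case False
  then show thesis using that by (simp add: KL2_def)
qed

text \<open>Equality fails at 0 and at infinity, where the product is 0. The inequality cancels a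
  density against its inverse at every point, with no exceptional null sets.\<close>

lemma ennreal_mult_inverse_le_one: "t * inverse t \<le> (1 :: ennreal)"
proof (cases t)
  case (real s)
  then show ?thesis
    by (cases "s = 0") (auto simp: inverse_ennreal ennreal_mult'[symmetric])
qed simp

text \<open>The Donsker--Varadhan bound for \<open>KL(J || Q \<Otimes> N)\<close>, which is the sum on the right by the chain rule.\<close>

lemma KL2_marginals_ge:
  fixes J :: "('a \<times> 'b) measure" and f :: "'a \<times> 'b \<Rightarrow> real"
  assumes J: "prob_space J" and P: "prob_space P" and N: "prob_space N" and Q: "prob_space Q"
    and sJ: "sets J = sets (P \<Otimes>\<^sub>M N)" and sP: "sets P = sets Q"
    and PJ: "distr J P fst = P"
    and f: "integrable J f"
    and le1: "\<And>y. y \<in> space N \<Longrightarrow> (\<integral>\<^sup>+ x. ennreal (exp (f (x, y))) \<partial>Q) \<le> 1"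
  shows "ereal ((\<integral>z. f z \<partial>J) / ln 2) \<le> KL2 J (P \<Otimes>\<^sub>M N) + KL2 P Q"
proof -
  interpret J: prob_space J by fact
  interpret P: prob_space P by fact
  interpret N: prob_space N by fact
  interpret Q: prob_space Q by fact
  interpret PN: pair_prob_space P N ..
  interpret QN: pair_prob_space Q N ..
  have fPN: "finite_measure (P \<Otimes>\<^sub>M N)" by unfold_locales
  note [measurable_cong] = sJ sP
  have fm[measurable]: "f \<in> borel_measurable (P \<Otimes>\<^sub>M N)"
    using borel_measurable_integrable[OF f] measurable_cong_sets[OF sJ refl] by auto
  show ?thesis
  proof (rule KL2_cases[OF fPN sJ])
    assume "KL2 J (P \<Otimes>\<^sub>M N) = \<infinity>"
    then show ?thesis by simp
  next
    assume ac: "absolutely_continuous (P \<Otimes>\<^sub>M N) J"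
      and int1: "integrable J (\<lambda>x. log 2 (enn2real (RN_deriv (P \<Otimes>\<^sub>M N) J x)))"
      and KL1: "KL2 J (P \<Otimes>\<^sub>M N) = ereal (\<integral>x. log 2 (enn2real (RN_deriv (P \<Otimes>\<^sub>M N) J x)) \<partial>J)"
    show ?thesis
    proof (rule KL2_cases[OF Q.finite_measure_axioms sP])
      assume "KL2 P Q = \<infinity>"
      then show ?thesis using KL1 by simp
    next
      assume ac2: "absolutely_continuous Q P"
        and int2: "integrable P (\<lambda>x. log 2 (enn2real (RN_deriv Q P x)))"
        and KL2: "KL2 P Q = ereal (\<integral>x. log 2 (enn2real (RN_deriv Q P x)) \<partial>P)"
      define r where "r = RN_deriv (P \<Otimes>\<^sub>M N) J"
      define s where "s = RN_deriv Q P"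
      have rm[measurable]: "r \<in> borel_measurable (P \<Otimes>\<^sub>M N)" unfolding r_def by simp
      have sm[measurable]: "s \<in> borel_measurable Q" unfolding s_def by simp
      have smP[measurable]: "s \<in> borel_measurable P" using sm measurable_cong_sets[OF sP refl] by auto
      have Jd: "density (P \<Otimes>\<^sub>M N) r = J"
        unfolding r_def using ac sJ by (rule PN.density_RN_deriv)
      have Pd: "density Q s = P"
        unfolding s_def using ac2 sP by (rule Q.density_RN_deriv)
      \<comment> \<open>\<open>J\<close> gives no mass to the zero set of its own density, and the
        density is finite almost everywhere; hence real logarithms and inverses of \<open>r\<close>
        behave as expected \<open>J\<close>-almost everywhere.\<close>
      have rfin: "AE z in J. 0 < r z \<and> r z < \<infinity>"
      proof -
        have "AE z in P \<Otimes>\<^sub>M N. r z \<noteq> \<infinity>"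
          unfolding r_def by (rule PN.RN_deriv_finite[OF _ ac sJ]) unfold_locales
        then have "AE z in density (P \<Otimes>\<^sub>M N) r. 0 < r z \<and> r z < \<infinity>"
          by (subst AE_density) (auto simp: top.not_eq_extremum)
        then show ?thesis unfolding Jd .
      qed
      have sfin0: "AE x in P. 0 < s x \<and> s x < \<infinity>"
      proof -
        have "AE x in Q. s x \<noteq> \<infinity>"
          unfolding s_def by (rule Q.RN_deriv_finite[OF _ ac2 sP]) unfold_locales
        then have "AE x in density Q s. 0 < s x \<and> s x < \<infinity>"
          by (subst AE_density) (auto simp: top.not_eq_extremum)
        then show ?thesis unfolding Pd .
      qed
      have fstm[measurable]: "fst \<in> J \<rightarrow>\<^sub>M P" by measurable
      have sfin: "AE z in J. 0 < s (fst z) \<and> s (fst z) < \<infinity>"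
      proof -
        have "AE x in distr J P fst. 0 < s x \<and> s x < \<infinity>" unfolding PJ by (rule sfin0)
        then show ?thesis by (subst (asm) AE_distr_iff) auto
      qed
      \<comment> \<open>\<open>exp (u z)\<close> is the quotient of \<open>exp (f z)\<close> by
        \<open>r z * s (fst z)\<close>, the density of \<open>J\<close> relative to
        \<open>Q \<Otimes>\<^sub>M N\<close>. Once its \<open>J\<close>-expectation is at most 1,
        the inequality \<open>1 + u \<le> exp u\<close> makes the expectation of \<open>u\<close>
        nonpositive, which is the claim in natural logarithms.\<close>
      define u where "u z = f z - ln (enn2real (r z)) - ln (enn2real (s (fst z)))" for z
      have int1': "integrable J (\<lambda>z. ln (enn2real (r z)))"
        using integrable_mult_right[OF int1, of "ln 2"] by (simp add: log_def r_def)
      have int2': "integrable J (\<lambda>z. ln (enn2real (s (fst z))))"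
      proof -
        have "integrable (distr J P fst) (\<lambda>x. ln (enn2real (s x)))"
          unfolding PJ using integrable_mult_right[OF int2, of "ln 2"] by (simp add: log_def s_def)
        then show ?thesis by (subst (asm) integrable_distr_eq) auto
      qed
      have eq2: "(\<integral>z. ln (enn2real (s (fst z))) \<partial>J) = (\<integral>x. ln (enn2real (s x)) \<partial>P)"
      proof -
        have "(\<integral>x. ln (enn2real (s x)) \<partial>distr J P fst) = (\<integral>z. ln (enn2real (s (fst z))) \<partial>J)"
          by (subst integral_distr) auto
        then show ?thesis unfolding PJ by simp
      qed
      have intu: "integrable J u" unfolding u_def using f int1' int2' by auto
      have Ju: "(\<integral>z. u z \<partial>J) = (\<integral>z. f z \<partial>J) - (\<integral>z. ln (enn2real (r z)) \<partial>J)
          - (\<integral>x. ln (enn2real (s x)) \<partial>P)"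
        unfolding u_def using f int1' int2' eq2 by simp
      have nn: "(\<integral>\<^sup>+ z. ennreal (exp (u z)) \<partial>J) \<le> 1"
      proof -
        have "(\<integral>\<^sup>+ z. ennreal (exp (u z)) \<partial>J)
            = (\<integral>\<^sup>+ z. ennreal (exp (f z)) * inverse (s (fst z)) * inverse (r z) \<partial>J)"
        proof (rule nn_integral_cong_AE)
          show "AE z in J. ennreal (exp (u z))
              = ennreal (exp (f z)) * inverse (s (fst z)) * inverse (r z)"
            using rfin sfin
          proof eventually_elim
            case (elim z)
            obtain a where a: "r z = ennreal a" "a > 0"
              using elim by (cases "r z") auto
            obtain b where b: "s (fst z) = ennreal b" "b > 0"
              using elim by (cases "s (fst z)") auto
            have "exp (u z) = exp (f z) * inverse b * inverse a"
              using a b by (simp add: u_def exp_diff exp_add field_simps)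
            then show ?case
              using a b by (simp add: ennreal_mult inverse_ennreal)
          qed
        qed
        also have "\<dots> = (\<integral>\<^sup>+ z. r z * (ennreal (exp (f z)) * inverse (s (fst z)) * inverse (r z)) \<partial>(P \<Otimes>\<^sub>M N))"
          by (subst Jd[symmetric], subst nn_integral_density) auto
        also have "\<dots> \<le> (\<integral>\<^sup>+ z. ennreal (exp (f z)) * inverse (s (fst z)) \<partial>(P \<Otimes>\<^sub>M N))"
        proof (rule nn_integral_mono)
          fix z
          have "r z * inverse (r z) \<le> 1"
            by (rule ennreal_mult_inverse_le_one)
          then have "(ennreal (exp (f z)) * inverse (s (fst z))) * (r z * inverse (r z))
              \<le> (ennreal (exp (f z)) * inverse (s (fst z))) * 1"
            by (intro mult_left_mono) auto
          then show "r z * (ennreal (exp (f z)) * inverse (s (fst z)) * inverse (r z))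
              \<le> ennreal (exp (f z)) * inverse (s (fst z))"
            by (simp add: ac_simps)
        qed
        also have "\<dots> = (\<integral>\<^sup>+ y. \<integral>\<^sup>+ x. ennreal (exp (f (x, y))) * inverse (s x) \<partial>P \<partial>N)"
          by (subst PN.nn_integral_snd[symmetric]) auto
        \<comment> \<open>For fixed \<open>y\<close> the density \<open>s\<close> changes
          \<open>P\<close> back to \<open>Q\<close>, so that the normalisation \<open>le1\<close> of
          \<open>f\<close> applies.\<close>
        also have "\<dots> \<le> (\<integral>\<^sup>+ y. 1 \<partial>N)"
        proof (rule nn_integral_mono)
          fix y assume y: "y \<in> space N"
          have [measurable]: "(\<lambda>x. f (x, y)) \<in> borel_measurable Q"
            using y by measurable
          have "(\<integral>\<^sup>+ x. ennreal (exp (f (x, y))) * inverse (s x) \<partial>P)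
              = (\<integral>\<^sup>+ x. s x * (ennreal (exp (f (x, y))) * inverse (s x)) \<partial>Q)"
            by (subst Pd[symmetric], subst nn_integral_density) auto
          also have "\<dots> \<le> (\<integral>\<^sup>+ x. ennreal (exp (f (x, y))) \<partial>Q)"
          proof (rule nn_integral_mono)
            fix x
            have "s x * inverse (s x) \<le> 1"
              by (rule ennreal_mult_inverse_le_one)
            then have "ennreal (exp (f (x, y))) * (s x * inverse (s x)) \<le> ennreal (exp (f (x, y))) * 1"
              by (intro mult_left_mono) auto
            then show "s x * (ennreal (exp (f (x, y))) * inverse (s x)) \<le> ennreal (exp (f (x, y)))"
              by (simp add: ac_simps)
          qed
          also have "\<dots> \<le> 1" by (rule le1[OF y])
          finally show "(\<integral>\<^sup>+ x. ennreal (exp (f (x, y))) * inverse (s x) \<partial>P) \<le> 1" .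
        qed
        also have "\<dots> = 1" by (simp add: N.emeasure_space_1)
        finally show ?thesis .
      qed
      have um[measurable]: "u \<in> borel_measurable J" using intu by auto
      have inte: "integrable J (\<lambda>z. exp (u z))"
        using le_less_trans[OF nn ennreal_one_less_top] by (intro integrableI_bounded) auto
      have "(\<integral>z. exp (u z) \<partial>J) \<le> 1"
        using nn by (simp add: nn_integral_eq_integral[OF inte])
      moreover have "(\<integral>z. 1 + u z \<partial>J) \<le> (\<integral>z. exp (u z) \<partial>J)"
        using intu inte by (intro integral_mono) auto
      ultimately have "(\<integral>z. u z \<partial>J) \<le> 0"
        using intu by (simp add: J.prob_space)
      then have "(\<integral>z. f z \<partial>J) / ln 2 \<le> (\<integral>z. ln (enn2real (r z)) \<partial>J) / ln 2
          + (\<integral>x. ln (enn2real (s x)) \<partial>P) / ln 2"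
        unfolding Ju by (simp add: add_divide_distrib[symmetric] divide_right_mono)
      then show ?thesis
        unfolding KL1 KL2 by (simp add: log_def r_def s_def)
    qed
  qed
qed

section \<open>Gaussian product densities\<close>

text \<open>Density of a Gaussian vector with independent coordinates. The argument \<open>v\<close>
  holds variances, whereas \<open>normal_density\<close> expects standard deviations, hence the
  square root. The product form lets integrals split into one-dimensional ones.\<close>

definition gauss_prod :: "('m::finite \<Rightarrow> real) \<Rightarrow> ('m \<Rightarrow> real) \<Rightarrow> real ^ 'm \<Rightarrow> real" where
  "gauss_prod m v x = (\<Prod>i\<in>UNIV. normal_density (m i) (sqrt (v i)) (x $ i))"

lemma gauss_prod_nonneg: "gauss_prod m v x \<ge> 0"
  by (simp add: gauss_prod_def prod_nonneg)

lemma gauss_prod_pos: "(\<And>i. v i > 0) \<Longrightarrow> gauss_prod m v x > 0"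
  by (simp add: gauss_prod_def prod_pos normal_density_pos)

lemma measurable_vec_nth_compose [measurable (raw)]:
  fixes f :: "'a \<Rightarrow> real ^ 'm"
  assumes "f \<in> borel_measurable M"
  shows "(\<lambda>x. f x $ i) \<in> borel_measurable M"
  by (rule measurable_compose[OF assms]) (intro borel_measurable_continuous_onI continuous_intros)

lemma measurable_gauss_prod [measurable (raw)]:
  fixes m :: "'m::finite \<Rightarrow> 'a \<Rightarrow> real"
  assumes [measurable]: "\<And>i. m i \<in> borel_measurable M" "f \<in> borel_measurable M"
  shows "(\<lambda>x. gauss_prod (\<lambda>i. m i x) v (f x)) \<in> borel_measurable M"
  unfolding gauss_prod_def normal_density_def by measurable

lemma measurable_vec_lambda [measurable (raw)]:
  fixes f :: "'m::finite \<Rightarrow> 'a \<Rightarrow> real"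
  assumes [measurable]: "\<And>i. f i \<in> borel_measurable M"
  shows "(\<lambda>x. \<chi> i. f i x) \<in> borel_measurable M"
proof (rule borel_measurable_euclidean_space[THEN iffD2], intro ballI)
  fix b :: "real ^ 'm" assume "b \<in> Basis"
  then obtain i where "b = axis i 1" by (auto simp: Basis_vec_def)
  then show "(\<lambda>x. (\<chi> i. f i x) \<bullet> b) \<in> borel_measurable M"
    by (simp add: inner_axis)
qed

text \<open>This is Tonelli for product integrands. The product integral over \<open>lborel\<close>
  is indexed by \<open>Basis\<close>, and the bijection between \<open>i\<close> and
  \<open>axis i 1\<close> re-indexes it by coordinates; \<open>SOME\<close> in \<open>h\<close>
  inverts that bijection.\<close>

lemma nn_integral_lborel_vec_prod:
  fixes f :: "'m::finite \<Rightarrow> real \<Rightarrow> ennreal"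
  assumes [measurable]: "\<And>i. f i \<in> borel_measurable borel"
  shows "(\<integral>\<^sup>+ x. (\<Prod>i\<in>UNIV. f i (x $ i)) \<partial>(lborel :: (real ^ 'm) measure))
    = (\<Prod>i\<in>UNIV. \<integral>\<^sup>+ t. f i t \<partial>lborel)"
proof -
  define h where "h b = f (SOME i. b = axis i (1::real))" for b
  have h: "h (axis i 1) = f i" for i
    by (simp add: h_def axis_eq_axis)
  have Basis: "(Basis :: (real ^ 'm) set) = (\<lambda>i. axis i 1) ` UNIV"
    by (auto simp: Basis_vec_def)
  have inj: "inj_on (\<lambda>i::'m. axis i (1::real)) UNIV"
    by (auto intro!: injI simp: axis_eq_axis)
  have "(\<integral>\<^sup>+ x. (\<Prod>b\<in>Basis. h b (x \<bullet> b)) \<partial>(lborel :: (real ^ 'm) measure))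
      = (\<Prod>b\<in>(Basis :: (real ^ 'm) set). \<integral>\<^sup>+ t. h b t \<partial>lborel)"
    by (rule nn_integral_lborel_prod) (auto simp: h_def)
  then show ?thesis
    unfolding Basis by (simp add: prod.reindex[OF inj] h inner_axis comp_def)
qed

lemma nn_integral_normal_density:
  "s > 0 \<Longrightarrow> (\<integral>\<^sup>+ x. ennreal (normal_density m s x) \<partial>lborel) = 1"
  by (simp add: nn_integral_eq_integral)

lemma nn_integral_normal_second_moment:
  assumes "s > 0"
  shows "(\<integral>\<^sup>+ x. ennreal ((x - m)\<^sup>2 * normal_density m s x) \<partial>lborel) = ennreal (s\<^sup>2)"
proof -
  have "(\<integral>x. normal_density m s x * (x - m) ^ (2 * 1) \<partial>lborel) = fact (2 * 1) / ((2 / s\<^sup>2) ^ 1 * fact 1)"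
    by (rule integral_normal_moment_even[OF assms])
  then have "(\<integral>x. (x - m)\<^sup>2 * normal_density m s x \<partial>lborel) = s\<^sup>2"
    by (simp add: mult.commute)
  moreover have "integrable lborel (\<lambda>x. (x - m)\<^sup>2 * normal_density m s x)"
    using integrable_normal_moment[OF assms, of m 2] by (simp add: mult.commute)
  ultimately show ?thesis
    by (subst nn_integral_eq_integral) auto
qed

lemma nn_integral_gauss_prod:
  assumes "\<And>i. v i > 0"
  shows "(\<integral>\<^sup>+ x. ennreal (gauss_prod m v x) \<partial>lborel) = 1"
  using assms nn_integral_lborel_vec_prod[of "\<lambda>i t. ennreal (normal_density (m i) (sqrt (v i)) t)"]
  by (simp add: gauss_prod_def prod_ennreal[symmetric] nn_integral_normal_density)

lemma nn_integral_gauss_prod_second_moment: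
  fixes m :: "'m::finite \<Rightarrow> real"
  assumes "\<And>i. v i > 0"
  shows "(\<integral>\<^sup>+ x. ennreal ((x $ i - m i)\<^sup>2 * gauss_prod m v x) \<partial>lborel) = ennreal (v i)"
proof -
  let ?f = "\<lambda>j t. if j = i then ennreal ((t - m i)\<^sup>2 * normal_density (m i) (sqrt (v i)) t)
      else ennreal (normal_density (m j) (sqrt (v j)) t)"
  have "ennreal ((x $ i - m i)\<^sup>2 * gauss_prod m v x) = (\<Prod>j\<in>UNIV. ?f j (x $ j))" for x
  proof -
    have "(\<Prod>j\<in>UNIV. ?f j (x $ j)) = ?f i (x $ i) * (\<Prod>j\<in>UNIV - {i}. ?f j (x $ j))"
      by (rule prod.remove) auto
    also have "(\<Prod>j\<in>UNIV - {i}. ?f j (x $ j))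
        = (\<Prod>j\<in>UNIV - {i}. ennreal (normal_density (m j) (sqrt (v j)) (x $ j)))"
      by (rule prod.cong) auto
    also have "\<dots> = ennreal (\<Prod>j\<in>UNIV - {i}. normal_density (m j) (sqrt (v j)) (x $ j))"
      by (rule prod_ennreal) simp
    finally show ?thesis
      by (simp add: gauss_prod_def prod.remove[of UNIV i] ennreal_mult'[symmetric] mult.assoc)
  qed
  then have "(\<integral>\<^sup>+ x. ennreal ((x $ i - m i)\<^sup>2 * gauss_prod m v x) \<partial>lborel)
      = (\<Prod>j\<in>UNIV. \<integral>\<^sup>+ t. ?f j t \<partial>lborel)"
    by (simp only:) (rule nn_integral_lborel_vec_prod, simp)
  also have "\<dots> = (\<Prod>j\<in>UNIV. if j = i then ennreal (v i) else 1)"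
    using assms by (intro prod.cong)
      (auto simp: nn_integral_normal_density nn_integral_normal_second_moment less_imp_le)
  finally show ?thesis by simp
qed

text \<open>The integral is the density of a scaled normal variable plus independent noise, so
  variances add. The substitution \<open>y = a * w\<close> reduces it to a convolution of centred
  normals; it degenerates at \<open>a = 0\<close>, where the first factor is constant in
  \<open>w\<close>.\<close>

lemma nn_integral_normal_mixture:
  assumes v: "v > 0" and u: "u > 0"
  shows "(\<integral>\<^sup>+ w. ennreal (normal_density (a * w) (sqrt v) z * normal_density 0 (sqrt u) w) \<partial>lborel)
    = ennreal (normal_density 0 (sqrt (a\<^sup>2 * u + v)) z)"
proof (cases "a = 0")
  case True
  have "(\<integral>\<^sup>+ w. ennreal (normal_density 0 (sqrt v) z) * ennreal (normal_density 0 (sqrt u) w) \<partial>lborel)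
      = ennreal (normal_density 0 (sqrt v) z)"
    using u by (subst nn_integral_cmult) (auto simp: nn_integral_normal_density)
  then show ?thesis using True by (simp add: ennreal_mult')
next
  case False
  have *: "normal_density 0 (\<bar>a\<bar> * sqrt u) (a * w) * \<bar>a\<bar> = normal_density 0 (sqrt u) w" for w
    using False u by (simp add: normal_density_def real_sqrt_mult power_mult_distrib field_simps)
  have **: "normal_density 0 (sqrt v) (z - a * w) = normal_density (a * w) (sqrt v) z" for w
    by (simp add: normal_density_def)
  have "(\<lambda>x. \<integral>\<^sup>+y. ennreal (normal_density 0 (sqrt v) (x - y) * normal_density 0 (\<bar>a\<bar> * sqrt u) y) \<partial>lborel) z =
      ennreal (normal_density 0 (sqrt ((sqrt v)\<^sup>2 + (\<bar>a\<bar> * sqrt u)\<^sup>2)) z)"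
    by (rule fun_cong[OF conv_normal_density_zero_mean]) (use False u v in auto)
  then have "(\<integral>\<^sup>+y. ennreal (normal_density 0 (sqrt v) (z - y) * normal_density 0 (\<bar>a\<bar> * sqrt u) y) \<partial>lborel)
      = ennreal (normal_density 0 (sqrt (a\<^sup>2 * u + v)) z)"
    using u v by (simp add: power_mult_distrib add.commute)
  moreover have "(\<integral>\<^sup>+y. ennreal (normal_density 0 (sqrt v) (z - y) * normal_density 0 (\<bar>a\<bar> * sqrt u) y) \<partial>lborel)
      = ennreal \<bar>a\<bar> * (\<integral>\<^sup>+w. ennreal (normal_density 0 (sqrt v) (z - (0 + a * w))
          * normal_density 0 (\<bar>a\<bar> * sqrt u) (0 + a * w)) \<partial>lborel)"
    using False by (intro nn_integral_real_affine) auto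
  moreover have "\<dots> = (\<integral>\<^sup>+w. ennreal (normal_density (a * w) (sqrt v) z * normal_density 0 (sqrt u) w) \<partial>lborel)"
  proof -
    have "ennreal \<bar>a\<bar> * ennreal (normal_density 0 (sqrt v) (z - (0 + a * w))
          * normal_density 0 (\<bar>a\<bar> * sqrt u) (0 + a * w))
        = ennreal (normal_density (a * w) (sqrt v) z * normal_density 0 (sqrt u) w)" for w
      unfolding *[symmetric] **[symmetric] by (simp add: ennreal_mult'[symmetric] mult_ac)
    then show ?thesis by (subst nn_integral_cmult[symmetric]) auto
  qed
  ultimately show ?thesis by simp
qed

lemma nn_integral_gauss_prod_mixture:
  fixes a :: "'m::finite \<Rightarrow> real"
  assumes "\<And>i. v i > 0" and "\<And>i. u i > 0"
  shows "(\<integral>\<^sup>+ w. ennreal (gauss_prod (\<lambda>i. a i * w $ i) v z * gauss_prod (\<lambda>_. 0) u w) \<partial>lborel)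
    = ennreal (gauss_prod (\<lambda>_. 0) (\<lambda>i. (a i)\<^sup>2 * u i + v i) z)"
proof -
  have "(\<integral>\<^sup>+ w. ennreal (gauss_prod (\<lambda>i. a i * w $ i) v z * gauss_prod (\<lambda>_. 0) u w) \<partial>lborel)
      = (\<integral>\<^sup>+ w. (\<Prod>i\<in>UNIV. ennreal (normal_density (a i * w $ i) (sqrt (v i)) (z $ i)
          * normal_density 0 (sqrt (u i)) (w $ i))) \<partial>lborel)"
    by (simp add: gauss_prod_def prod_ennreal prod.distrib)
  also have "\<dots> = (\<Prod>i\<in>UNIV. \<integral>\<^sup>+ t. ennreal (normal_density (a i * t) (sqrt (v i)) (z $ i)
          * normal_density 0 (sqrt (u i)) t) \<partial>lborel)"
    by (rule nn_integral_lborel_vec_prod) (auto simp: normal_density_def)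
  also have "\<dots> = ennreal (gauss_prod (\<lambda>_. 0) (\<lambda>i. (a i)\<^sup>2 * u i + v i) z)"
    using assms by (simp add: nn_integral_normal_mixture prod_ennreal gauss_prod_def)
  finally show ?thesis .
qed

lemma mvn_density_diag:
  fixes v :: "'m::finite \<Rightarrow> real"
  assumes v: "\<And>i. v i > 0"
  shows "mvn_density 0 (\<chi> i j. if i = j then v i else 0) = gauss_prod (\<lambda>_. 0) v"
proof
  fix x :: "real ^ 'm"
  let ?S = "(\<chi> i j. if i = j then v i else 0) :: real ^ 'm ^ 'm"
  let ?T = "(\<chi> i j. if i = j then 1 / v i else 0) :: real ^ 'm ^ 'm"
  have v0: "v i \<noteq> 0" for i using v[of i] by simp
  have ST: "?S ** ?T = mat 1" "?T ** ?S = mat 1"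
    by (auto simp: matrix_matrix_mult_def mat_def vec_eq_iff v0 if_distrib[of "\<lambda>t. t * _"]
        if_distrib[of "(*) _"] cong: if_cong)
  \<comment> \<open>\<open>matrix_inv\<close> is a choice, so \<open>?T\<close> serves first as a
    witness that an inverse exists; associativity then identifies the chosen inverse with
    \<open>?T\<close>.\<close>
  have "matrix_inv ?S ** ?S = mat 1"
    unfolding matrix_inv_def
    using someI[of "\<lambda>A. ?S ** A = mat 1 \<and> A ** ?S = mat 1" ?T] ST by blast
  then have inv: "matrix_inv ?S = ?T"
    using matrix_mul_assoc[of "matrix_inv ?S" ?S ?T] ST(1) by simp
  have det: "det ?S = (\<Prod>i\<in>UNIV. v i)"
    by (subst det_diagonal) auto
  have "?T *v x = (\<chi> i. x $ i / v i)"
    by (auto simp: matrix_vector_mult_def vec_eq_iff if_distrib[of "\<lambda>t. t * _"] cong: if_cong)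
  then have quad: "x \<bullet> (?T *v x) = (\<Sum>i\<in>UNIV. (x $ i)\<^sup>2 / v i)"
    by (simp add: inner_vec_def power2_eq_square)
  have "gauss_prod (\<lambda>_. 0) v x
      = (\<Prod>i\<in>UNIV. 1 / sqrt (2 * pi * v i)) * (\<Prod>i\<in>UNIV. exp (- (x $ i)\<^sup>2 / (2 * v i)))"
    using v by (simp add: gauss_prod_def normal_density_def prod.distrib[symmetric] less_imp_le)
  also have "(\<Prod>i\<in>UNIV. 1 / sqrt (2 * pi * v i)) = 1 / sqrt ((2 * pi) ^ CARD('m) * (\<Prod>i\<in>UNIV. v i))"
  proof -
    have "(\<Prod>i\<in>A. sqrt (f i)) = sqrt (\<Prod>i\<in>A. f i)" if "finite A" for A :: "'m set" and f
      using that by (induct rule: finite_induct) (auto simp: real_sqrt_mult)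
    from this[of UNIV "\<lambda>i. 2 * pi * v i"] show ?thesis
      by (simp add: prod_dividef prod.distrib)
  qed
  also have "(\<Prod>i\<in>UNIV. exp (- (x $ i)\<^sup>2 / (2 * v i))) = exp (- (\<Sum>i\<in>UNIV. (x $ i)\<^sup>2 / v i) / 2)"
    by (simp add: exp_sum[symmetric] sum_negf sum_divide_distrib mult.commute)
  finally show "mvn_density 0 ?S x = gauss_prod (\<lambda>_. 0) v x"
    by (simp add: mvn_density_def inv det quad)
qed

lemma prob_space_gauss_prod:
  "(\<And>i. v i > 0) \<Longrightarrow> prob_space (density lborel (\<lambda>x. ennreal (gauss_prod m v x)))"
  by (intro prob_spaceI) (simp add: emeasure_density nn_integral_gauss_prod)

text \<open>The log-ratio of two such densities is a quadratic polynomial in the coordinates. Its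
  expectation is therefore fixed by second moments around the two means, whatever the law of
  \<open>x\<close>; the exact information values below rest on this.\<close>

lemma ln_gauss_prod_ratio:
  fixes v u :: "'m::finite \<Rightarrow> real"
  assumes "\<And>i. v i > 0" "\<And>i. u i > 0"
  shows "ln (gauss_prod m v x / gauss_prod n u x) = (\<Sum>i\<in>UNIV. ln (u i / v i) / 2
    - (x $ i - m i)\<^sup>2 / (2 * v i) + (x $ i - n i)\<^sup>2 / (2 * u i))"
proof -
  have nd: "normal_density (m i) (sqrt (v i)) t / normal_density (n i) (sqrt (u i)) t
     = exp (ln (u i / v i) / 2 - (t - m i)\<^sup>2 / (2 * v i) + (t - n i)\<^sup>2 / (2 * u i))" for i t
  proof -
    have "exp (ln (u i / v i) / 2) = sqrt (u i / v i)"
      using assms(1)[of i] assms(2)[of i] by (simp add: ln_sqrt[symmetric])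
    then have "exp (ln (u i / v i) / 2 - (t - m i)\<^sup>2 / (2 * v i) + (t - n i)\<^sup>2 / (2 * u i))
        = sqrt (u i) / sqrt (v i) * exp (- ((t - m i)\<^sup>2 / (2 * v i))) * exp ((t - n i)\<^sup>2 / (2 * u i))"
      by (simp only: exp_add diff_conv_add_uminus real_sqrt_divide)
    moreover have "normal_density (m i) (sqrt (v i)) t
        = exp (- ((t - m i)\<^sup>2 / (2 * v i))) / (sqrt (2 * pi) * sqrt (v i))"
      "normal_density (n i) (sqrt (u i)) t
        = inverse (exp ((t - n i)\<^sup>2 / (2 * u i))) / (sqrt (2 * pi) * sqrt (u i))"
      using assms(1)[of i] assms(2)[of i]
      by (simp_all add: normal_density_def real_sqrt_mult exp_minus)
    ultimately show ?thesis by (simp add: field_simps)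
  qed
  have "gauss_prod m v x / gauss_prod n u x = (\<Prod>i\<in>UNIV. exp (ln (u i / v i) / 2
      - (x $ i - m i)\<^sup>2 / (2 * v i) + (x $ i - n i)\<^sup>2 / (2 * u i)))"
    by (simp add: gauss_prod_def prod_dividef[symmetric] nd)
  then show ?thesis by (simp add: exp_sum[symmetric])
qed

section \<open>Lower bound on the rate-distortion function\<close>

context
  fixes P :: "'a::topological_space measure" and K :: "'a \<Rightarrow> 'b::topological_space measure"
  assumes P: "prob_space P" and sP [measurable_cong]: "sets P = sets borel"
    and K: "K \<in> borel \<rightarrow>\<^sub>M prob_algebra borel"
begin

lemma kernel_pair_measurable:
  "(\<lambda>x. distr (K x) (borel \<Otimes>\<^sub>M borel) (\<lambda>y. (x, y))) \<in> P \<rightarrow>\<^sub>M prob_algebra (borel \<Otimes>\<^sub>M borel)"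
proof -
  have [measurable]: "K \<in> P \<rightarrow>\<^sub>M prob_algebra borel"
    using K measurable_cong_sets[OF sP refl] by auto
  show ?thesis by measurable
qed

lemma prob_space_joint_kernel: "prob_space (joint_kernel P K)"
  unfolding joint_kernel_def
  using P kernel_pair_measurable by (intro prob_space_bind'[OF _ kernel_pair_measurable])
    (auto simp: space_prob_algebra)

lemma sets_joint_kernel: "sets (joint_kernel P K) = sets (borel \<Otimes>\<^sub>M borel)"
  unfolding joint_kernel_def
  using P by (intro sets_bind'[OF _ kernel_pair_measurable]) (auto simp: space_prob_algebra)

lemma kernel_space:
  "sets (K x) = sets borel" "prob_space (K x)"
  using measurable_space[OF K, of x] by (auto simp: space_prob_algebra)

lemma nn_integral_joint_kernel:
  assumes g [measurable]: "g \<in> borel_measurable (borel \<Otimes>\<^sub>M borel)"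
  shows "(\<integral>\<^sup>+ z. g z \<partial>joint_kernel P K) = (\<integral>\<^sup>+ x. \<integral>\<^sup>+ y. g (x, y) \<partial>K x \<partial>P)"
proof -
  note [measurable_cong] = kernel_space(1)
  have "(\<integral>\<^sup>+ z. g z \<partial>joint_kernel P K)
      = (\<integral>\<^sup>+ x. \<integral>\<^sup>+ z. g z \<partial>distr (K x) (borel \<Otimes>\<^sub>M borel) (\<lambda>y. (x, y)) \<partial>P)"
    unfolding joint_kernel_def
    by (rule nn_integral_bind[OF g measurable_prob_algebraD[OF kernel_pair_measurable]])
  also have "\<dots> = (\<integral>\<^sup>+ x. \<integral>\<^sup>+ y. g (x, y) \<partial>K x \<partial>P)"
    by (intro nn_integral_cong) (simp add: nn_integral_distr)
  finally show ?thesis .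
qed

lemma distr_joint_kernel_fst: "distr (joint_kernel P K) borel fst = P"
proof (rule measure_eqI)
  fix A assume "A \<in> sets (distr (joint_kernel P K) borel fst)"
  then have A [measurable]: "A \<in> sets borel" by simp
  note [measurable_cong] = sets_joint_kernel
  have "emeasure (distr (joint_kernel P K) borel fst) A
      = (\<integral>\<^sup>+ z. indicator A (fst z) \<partial>joint_kernel P K)"
    using nn_integral_distr[of fst "joint_kernel P K" borel "indicator A"] by simp
  also have "\<dots> = (\<integral>\<^sup>+ x. \<integral>\<^sup>+ y. indicator A x \<partial>K x \<partial>P)"
    by (subst nn_integral_joint_kernel) auto
  also have "\<dots> = (\<integral>\<^sup>+ x. indicator A x \<partial>P)"
    by (intro nn_integral_cong) (simp add: prob_space.emeasure_space_1[OF kernel_space(2)])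
  also have "\<dots> = emeasure P A" by (simp add: sP)
  finally show "emeasure (distr (joint_kernel P K) borel fst) A = emeasure P A" .
qed (simp add: sP)

end

text \<open>Each coordinate of the dual function of the Gaussian rate-distortion problem at slope
  \<open>- 1 / (2 \<theta>)\<close>: its exponential turns \<open>N(0, v)\<close> into \<open>N(y, \<theta>)\<close> if \<open>\<theta> < v\<close>, and into a
  sub-probability proportional to \<open>N(v y / \<theta>, v)\<close> otherwise.\<close>

lemma nn_integral_waterfilling_dual_le_1:
  fixes v \<theta> y :: real
  assumes v: "v > 0" and \<theta>: "\<theta> > 0"
  shows "(\<integral>\<^sup>+ t. ennreal (exp (ln (v / min v \<theta>) / 2 - (t - y)\<^sup>2 / (2 * \<theta>) + t\<^sup>2 / (2 * max v \<theta>))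
    * normal_density 0 (sqrt v) t) \<partial>lborel) \<le> 1"
proof (cases "\<theta> < v")
  case True
  have "exp (ln (v / \<theta>) / 2 - (t - y)\<^sup>2 / (2 * \<theta>) + t\<^sup>2 / (2 * v)) * normal_density 0 (sqrt v) t
      = normal_density y (sqrt \<theta>) t" for t
  proof -
    have "exp (ln (v / \<theta>) / 2) = sqrt v / sqrt \<theta>"
      using v \<theta> by (simp add: ln_sqrt[symmetric] real_sqrt_divide)
    then have e: "exp (ln (v / \<theta>) / 2 - (t - y)\<^sup>2 / (2 * \<theta>) + t\<^sup>2 / (2 * v))
        = sqrt v / sqrt \<theta> * exp (- ((t - y)\<^sup>2 / (2 * \<theta>))) * exp (t\<^sup>2 / (2 * v))"
      by (simp only: exp_add diff_conv_add_uminus)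
    have n: "normal_density 0 (sqrt v) t = inverse (exp (t\<^sup>2 / (2 * v))) / (sqrt (2 * pi) * sqrt v)"
      "normal_density y (sqrt \<theta>) t = exp (- ((t - y)\<^sup>2 / (2 * \<theta>))) / (sqrt (2 * pi) * sqrt \<theta>)"
      using v \<theta> by (simp_all add: normal_density_def real_sqrt_mult exp_minus)
    show ?thesis using v \<theta> unfolding e n by (simp add: field_simps)
  qed
  then show ?thesis using True \<theta> by (simp add: min_def max_def nn_integral_normal_density)
next
  case False
  define c where "c = (v / \<theta> - 1) * y\<^sup>2 / (2 * \<theta>)"
  have c: "c \<le> 0"
    using False \<theta> unfolding c_def by (intro divide_nonpos_pos mult_nonpos_nonneg) (auto simp: field_simps)
  have "exp (- (t - y)\<^sup>2 / (2 * \<theta>) + t\<^sup>2 / (2 * \<theta>)) * normal_density 0 (sqrt v) t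
      = exp c * normal_density (v / \<theta> * y) (sqrt v) t" for t
  proof -
    have "- (t - y)\<^sup>2 / (2 * \<theta>) + t\<^sup>2 / (2 * \<theta>) + (- t\<^sup>2 / (2 * v)) = c + (- (t - v / \<theta> * y)\<^sup>2 / (2 * v))"
      using v \<theta> unfolding c_def by (simp add: field_simps power2_eq_square)
    then have "exp (- (t - y)\<^sup>2 / (2 * \<theta>) + t\<^sup>2 / (2 * \<theta>)) * exp (- t\<^sup>2 / (2 * v))
        = exp c * exp (- (t - v / \<theta> * y)\<^sup>2 / (2 * v))"
      by (simp only: exp_add[symmetric])
    then show ?thesis using v by (simp add: normal_density_def less_imp_le)
  qed
  then have "(\<integral>\<^sup>+ t. ennreal (exp (ln (v / min v \<theta>) / 2 - (t - y)\<^sup>2 / (2 * \<theta>) + t\<^sup>2 / (2 * max v \<theta>))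
    * normal_density 0 (sqrt v) t) \<partial>lborel)
      = (\<integral>\<^sup>+ t. ennreal (exp c) * ennreal (normal_density (v / \<theta> * y) (sqrt v) t) \<partial>lborel)"
    using False v by (intro nn_integral_cong) (simp add: min_def max_def ennreal_mult'[symmetric])
  also have "\<dots> = ennreal (exp c)"
    using v by (subst nn_integral_cmult) (auto simp: nn_integral_normal_density)
  also have "\<dots> \<le> 1" using c by simp
  finally show ?thesis .
qed

lemma norm_power2_vec: "(norm (x :: real ^ 'm))\<^sup>2 = (\<Sum>i\<in>UNIV. (x $ i)\<^sup>2)"
  unfolding power2_norm_eq_inner inner_vec_def by (simp add: power2_eq_square)

text \<open>\<open>KL2_marginals_ge\<close> is applied to each admissible kernel with the Gaussian
  dual function. The term \<open>KL2 P Q\<close> pays for normalising that function under the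
  Gaussian \<open>Q\<close> instead of \<open>P\<close>, so one argument serves Gaussian and general
  sources.\<close>

lemma rate_distortion_plus_KL2_ge:
  fixes P :: "(real ^ 'm) measure" and v :: "'m \<Rightarrow> real"
  assumes P: "prob_space P" and sP [measurable_cong]: "sets P = sets borel"
    and v: "\<And>i. v i > 0" and \<theta>: "\<theta> > 0"
    and mom: "\<And>i. (\<integral>\<^sup>+ x. ennreal ((x $ i)\<^sup>2) \<partial>P) = ennreal (v i)"
    and \<Delta>: "\<Delta> \<le> (\<Sum>i\<in>UNIV. min (v i) \<theta>)"
  shows "ereal (\<Sum>i\<in>UNIV. log 2 (v i / min (v i) \<theta>) / 2)
    \<le> rate_distortion P \<Delta> + KL2 P (density lborel (\<lambda>x. ennreal (gauss_prod (\<lambda>_. 0) v x)))"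
proof -
  define Q where "Q = density lborel (\<lambda>x. ennreal (gauss_prod (\<lambda>_. 0) v x))"
  define C where "C = (\<Sum>i\<in>UNIV. log 2 (v i / min (v i) \<theta>) / 2)"
  have Q: "prob_space Q" unfolding Q_def by (rule prob_space_gauss_prod[OF v])
  have sQ: "sets P = sets Q" by (simp add: Q_def sP)
  have main: "ereal C \<le> MI_joint (joint_kernel P K) borel borel + KL2 P Q"
    if K: "K \<in> borel \<rightarrow>\<^sub>M prob_algebra (borel :: (real ^ 'm) measure)"
      and dist: "(\<integral>\<^sup>+ z. ennreal ((norm (fst z - snd z))\<^sup>2) \<partial>joint_kernel P K) \<le> ennreal \<Delta>" for K
  proof -
    define J where "J = joint_kernel P K"
    define N where "N = distr J borel snd"
    have J: "prob_space J" unfolding J_def by (rule prob_space_joint_kernel[OF P sP K])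
    have sJ [measurable_cong]: "sets J = sets (borel \<Otimes>\<^sub>M borel)"
      unfolding J_def by (rule sets_joint_kernel[OF P sP K])
    have fstJ: "distr J borel fst = P" unfolding J_def by (rule distr_joint_kernel_fst[OF P sP K])
    have "distr J P fst = distr J borel fst" by (rule distr_cong) (auto simp: sP)
    then have fstJ': "distr J P fst = P" using fstJ by simp
    interpret J: prob_space J by fact
    have N: "prob_space N" unfolding N_def by (rule J.prob_space_distr) measurable
    have sJ': "sets J = sets (P \<Otimes>\<^sub>M N)"
      unfolding sJ by (rule sets_pair_measure_cong) (auto simp: sP N_def)
    have mom_eq: "(\<integral>\<^sup>+ z. ennreal ((fst z $ i)\<^sup>2) \<partial>J) = ennreal (v i)" for i
    proof -
      have "(\<integral>\<^sup>+ x. ennreal ((x $ i)\<^sup>2) \<partial>distr J borel fst) = (\<integral>\<^sup>+ z. ennreal ((fst z $ i)\<^sup>2) \<partial>J)"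
        by (subst nn_integral_distr) auto
      then show ?thesis using mom[of i] by (simp add: fstJ)
    qed
    have int_x: "integrable J (\<lambda>z. (fst z $ i)\<^sup>2)" for i
      by (rule integrableI_nn_integral_finite[OF _ _ mom_eq]) auto
    have E_x: "(\<integral>z. (fst z $ i)\<^sup>2 \<partial>J) = v i" for i
      using mom_eq[of i] v[of i] by (subst (asm) nn_integral_eq_integral[OF int_x]) auto
    have dist': "(\<integral>\<^sup>+ z. ennreal ((norm (fst z - snd z))\<^sup>2) \<partial>J) \<le> ennreal (\<Sum>i\<in>UNIV. min (v i) \<theta>)"
      using dist \<Delta> unfolding J_def by (meson ennreal_leI order_trans)
    have int_d: "integrable J (\<lambda>z. (norm (fst z - snd z))\<^sup>2)"
      by (rule integrableI_bounded) (use dist' in \<open>auto simp: le_less_trans\<close>)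
    \<comment> \<open>Since \<open>ennreal\<close> sends negative reals to 0, nonnegativity of the
      bound is what allows the distortion constraint to be read in the reals.\<close>
    have "0 \<le> (\<Sum>i\<in>UNIV. min (v i) \<theta>)"
      using v \<theta> by (intro sum_nonneg) (simp add: less_imp_le)
    then have E_d: "(\<integral>z. (norm (fst z - snd z))\<^sup>2 \<partial>J) \<le> (\<Sum>i\<in>UNIV. min (v i) \<theta>)"
      using dist' by (subst (asm) nn_integral_eq_integral[OF int_d]) auto
    \<comment> \<open>The logarithmic dual function, summed over coordinates, with
      \<open>y = snd z\<close>. By \<open>f_eq\<close> its expectation involves only the distortion
      and the second moments \<open>v\<close>. The \<open>max\<close> makes \<open>fst z $ i\<close>
      contribute a term that cancels the source exponent if \<open>\<theta> < v i\<close>, and the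
      quadratic part of the distortion term otherwise.\<close>
    define f where "f z = (\<Sum>i\<in>UNIV. ln (v i / min (v i) \<theta>) / 2 - (fst z $ i - snd z $ i)\<^sup>2 / (2 * \<theta>)
        + (fst z $ i)\<^sup>2 / (2 * max (v i) \<theta>))" for z :: "(real ^ 'm) \<times> (real ^ 'm)"
    have f_eq: "f z = C * ln 2 - (norm (fst z - snd z))\<^sup>2 / (2 * \<theta>)
        + (\<Sum>i\<in>UNIV. (fst z $ i)\<^sup>2 / (2 * max (v i) \<theta>))" for z
      unfolding f_def norm_power2_vec C_def log_def
      by (simp add: sum.distrib sum_subtractf sum_divide_distrib sum_distrib_right)
    have int_f: "integrable J f"
      unfolding f_eq using int_d int_x by auto
    have "(\<integral>z. f z \<partial>J) = C * ln 2 - (\<integral>z. (norm (fst z - snd z))\<^sup>2 \<partial>J) / (2 * \<theta>)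
        + (\<Sum>i\<in>UNIV. v i / (2 * max (v i) \<theta>))"
      unfolding f_eq using int_d int_x by (simp add: E_x J.prob_space)
    moreover have "(\<integral>z. (norm (fst z - snd z))\<^sup>2 \<partial>J) / (2 * \<theta>)
        \<le> (\<Sum>i\<in>UNIV. min (v i) \<theta>) / (2 * \<theta>)"
      using E_d \<theta> by (intro divide_right_mono) auto
    \<comment> \<open>From \<open>min (v i) \<theta> * max (v i) \<theta> = v i * \<theta>\<close>:
      at the largest permitted distortion the two quadratic contributions balance exactly, leaving
      \<open>C * ln 2\<close>.\<close>
    moreover have "(\<Sum>i\<in>UNIV. min (v i) \<theta>) / (2 * \<theta>) = (\<Sum>i\<in>UNIV. v i / (2 * max (v i) \<theta>))"
      unfolding sum_divide_distrib using v \<theta>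
      by (intro sum.cong) (auto simp: min_def max_def field_simps less_imp_neq)
    ultimately have "C * ln 2 \<le> (\<integral>z. f z \<partial>J)" by linarith
    then have "C \<le> (\<integral>z. f z \<partial>J) / ln 2" by (simp add: field_simps)
    moreover have "ereal ((\<integral>z. f z \<partial>J) / ln 2) \<le> KL2 J (P \<Otimes>\<^sub>M N) + KL2 P Q"
    proof (rule KL2_marginals_ge[OF J P N Q sJ' sQ fstJ' int_f])
      fix y assume "y \<in> space N"
      have "(\<integral>\<^sup>+ x. ennreal (exp (f (x, y))) \<partial>Q)
          = (\<integral>\<^sup>+ x. ennreal (gauss_prod (\<lambda>_. 0) v x) * ennreal (exp (f (x, y))) \<partial>lborel)"
        unfolding Q_def f_def by (subst nn_integral_density) auto
      also have "\<dots> = (\<integral>\<^sup>+ x. (\<Prod>i\<in>UNIV. ennreal (exp (ln (v i / min (v i) \<theta>) / 2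
          - (x $ i - y $ i)\<^sup>2 / (2 * \<theta>) + (x $ i)\<^sup>2 / (2 * max (v i) \<theta>))
          * normal_density 0 (sqrt (v i)) (x $ i))) \<partial>lborel)"
        by (intro nn_integral_cong)
          (simp add: f_def exp_sum prod_ennreal prod.distrib gauss_prod_def ennreal_mult'[symmetric]
            prod_nonneg mult.commute)
      also have "\<dots> = (\<Prod>i\<in>UNIV. \<integral>\<^sup>+ t. ennreal (exp (ln (v i / min (v i) \<theta>) / 2
          - (t - y $ i)\<^sup>2 / (2 * \<theta>) + t\<^sup>2 / (2 * max (v i) \<theta>))
          * normal_density 0 (sqrt (v i)) t) \<partial>lborel)"
        by (rule nn_integral_lborel_vec_prod) auto
      also have "\<dots> \<le> 1"
        using nn_integral_waterfilling_dual_le_1[OF v \<theta>] by (intro prod_le_1) auto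
      finally show "(\<integral>\<^sup>+ x. ennreal (exp (f (x, y))) \<partial>Q) \<le> 1" .
    qed
    ultimately show ?thesis
      unfolding MI_joint_def J_def[symmetric] fstJ N_def[symmetric]
      by (meson ereal_less_eq(3) order_trans)
  qed
  show ?thesis
    unfolding Q_def[symmetric] C_def[symmetric]
  proof (rule KL2_cases[OF prob_space.axioms(1)[OF Q] sQ])
    assume "KL2 P Q = \<infinity>"
    then show "ereal C \<le> rate_distortion P \<Delta> + KL2 P Q" by simp
  next
    assume eq: "KL2 P Q = ereal (\<integral>x. log 2 (enn2real (RN_deriv Q P x)) \<partial>P)"
    \<comment> \<open>A real divergence can be moved to the left-hand side; the bound then holds for
      each admissible kernel and passes to the infimum.\<close>
    define k where "k = (\<integral>x. log 2 (enn2real (RN_deriv Q P x)) \<partial>P)"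
    have "ereal (C - k) \<le> rate_distortion P \<Delta>"
      unfolding rate_distortion_def
    proof (rule INF_greatest)
      fix K assume "K \<in> {K. K \<in> borel \<rightarrow>\<^sub>M prob_algebra (borel :: (real ^ 'm) measure) \<and>
          (\<integral>\<^sup>+ z. ennreal ((norm (fst z - snd z))\<^sup>2) \<partial>joint_kernel P K) \<le> ennreal \<Delta>}"
      then have "ereal C \<le> MI_joint (joint_kernel P K) borel borel + ereal k"
        using main unfolding eq k_def by auto
      then show "ereal (C - k) \<le> MI_joint (joint_kernel P K) borel borel"
        by (cases "MI_joint (joint_kernel P K) borel borel") auto
    qed
    then show "ereal C \<le> rate_distortion P \<Delta> + KL2 P Q"
      unfolding eq k_def[symmetric] by (cases "rate_distortion P \<Delta>") auto
  qed
qed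

section \<open>Gaussian test channel\<close>

lemma second_moment_gauss_prod_measure:
  fixes v :: "'m::finite \<Rightarrow> real"
  assumes v: "\<And>i. v i > 0"
  shows "(\<integral>\<^sup>+ x. ennreal ((x $ i)\<^sup>2) \<partial>density lborel (\<lambda>x. ennreal (gauss_prod (\<lambda>_. 0) v x)))
    = ennreal (v i)"
proof -
  have "(\<integral>\<^sup>+ x. ennreal ((x $ i)\<^sup>2) \<partial>density lborel (\<lambda>x. ennreal (gauss_prod (\<lambda>_. 0) v x)))
      = (\<integral>\<^sup>+ x. ennreal ((x $ i - 0)\<^sup>2 * gauss_prod (\<lambda>_. 0) v x) \<partial>lborel)"
    by (subst nn_integral_density)
      (auto simp: ennreal_mult'[symmetric] gauss_prod_nonneg mult.commute)
  also have "\<dots> = ennreal (v i)"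
    by (rule nn_integral_gauss_prod_second_moment) (rule v)
  finally show ?thesis .
qed

text \<open>The test channel is given backwards: the reproduction has law \<open>\<nu> = N(0, v - s)\<close>, possibly
  degenerate, and the source is the reproduction plus independent \<open>N(0, s)\<close> noise; \<open>r\<close> is the
  resulting density of the joint law with respect to the product of the marginals.\<close>

lemma rate_distortion_gauss_prod_le:
  fixes v s :: "'m::finite \<Rightarrow> real"
  assumes s: "\<And>i. s i > 0" and sv: "\<And>i. s i \<le> v i"
  shows "rate_distortion (density lborel (\<lambda>x. ennreal (gauss_prod (\<lambda>_. 0) v x))) (\<Sum>i\<in>UNIV. s i)
    \<le> ereal (\<Sum>i\<in>UNIV. log 2 (v i / s i) / 2)"
proof -
  have v: "v i > 0" for i using s[of i] sv[of i] by linarith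
  define P where "P = density lborel (\<lambda>x. ennreal (gauss_prod (\<lambda>_. 0) v x))"
  define G where "G = density lborel (\<lambda>x :: real ^ 'm. ennreal (gauss_prod (\<lambda>_. 0) (\<lambda>_. 1) x))"
  \<comment> \<open>Scaling a standard normal vector yields variance \<open>v i - s i\<close> even
    where this is 0 and no Lebesgue density of \<open>\<nu>\<close> exists.\<close>
  define T where "T = (\<lambda>w :: real ^ 'm. \<chi> i. sqrt (v i - s i) * w $ i)"
  define \<nu> where "\<nu> = distr G borel T"
  define r where "r x y = gauss_prod (\<lambda>i. y $ i) s x / gauss_prod (\<lambda>_. 0) v x" for x y :: "real ^ 'm"
  define K where "K x = density \<nu> (\<lambda>y. ennreal (r x y))" for x
  define J where "J = joint_kernel P K"
  have P: "prob_space P" unfolding P_def by (rule prob_space_gauss_prod[OF v])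
  have G: "prob_space G" unfolding G_def by (rule prob_space_gauss_prod) simp
  have sP [measurable_cong]: "sets P = sets borel" by (simp add: P_def)
  have sG [measurable_cong]: "sets G = sets borel" by (simp add: G_def)
  have s\<nu> [measurable_cong]: "sets \<nu> = sets borel" by (simp add: \<nu>_def)
  have T [measurable]: "T \<in> borel \<rightarrow>\<^sub>M borel" unfolding T_def by measurable
  have \<nu>: "prob_space \<nu>" unfolding \<nu>_def by (rule prob_space.prob_space_distr[OF G]) measurable
  interpret P: prob_space P by fact
  interpret \<nu>: prob_space \<nu> by fact
  interpret PN: pair_prob_space P \<nu> ..
  have gv: "gauss_prod (\<lambda>_. 0) v x > 0" for x by (rule gauss_prod_pos[OF v])
  have r0: "r x y \<ge> 0" for x y by (simp add: r_def gauss_prod_nonneg)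
  have [measurable]: "(\<lambda>z. r (fst z) (snd z)) \<in> borel_measurable (borel \<Otimes>\<^sub>M borel)"
    unfolding r_def by measurable
  have r_y [measurable]: "r x \<in> borel_measurable borel" for x
    unfolding r_def by measurable
  have r_x [measurable]: "(\<lambda>x. r x y) \<in> borel_measurable borel" for y
    unfolding r_def by measurable
  \<comment> \<open>Averaging the \<open>N(y, s)\<close> density over the law of \<open>y\<close>
    gives variance \<open>(v i - s i) + s i = v i\<close>, which is the denominator of
    \<open>r\<close>. Hence \<open>K x\<close> has mass 1 for every \<open>x\<close>, not just
    almost every one.\<close>
  have r_1: "(\<integral>\<^sup>+ y. ennreal (r x y) \<partial>\<nu>) = 1" for x
  proof -
    have "(\<integral>\<^sup>+ y. ennreal (r x y) \<partial>\<nu>) = (\<integral>\<^sup>+ w. ennreal (r x (T w)) \<partial>G)"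
      unfolding \<nu>_def by (subst nn_integral_distr) auto
    also have "\<dots> = (\<integral>\<^sup>+ w. ennreal (gauss_prod (\<lambda>_. 0) (\<lambda>_. 1) w) * ennreal (r x (T w)) \<partial>lborel)"
      unfolding G_def by (subst nn_integral_density) auto
    also have "\<dots> = (\<integral>\<^sup>+ w. ennreal (1 / gauss_prod (\<lambda>_. 0) v x) *
        ennreal (gauss_prod (\<lambda>i. sqrt (v i - s i) * w $ i) s x * gauss_prod (\<lambda>_. 0) (\<lambda>_. 1) w) \<partial>lborel)"
      using gv[of x] by (intro nn_integral_cong)
        (simp add: r_def T_def ennreal_mult'[symmetric] gauss_prod_nonneg mult.commute)
    also have "\<dots> = ennreal (1 / gauss_prod (\<lambda>_. 0) v x) * ennreal (gauss_prod (\<lambda>_. 0) (\<lambda>i. (sqrt (v i - s i))\<^sup>2 * 1 + s i) x)"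
      by (subst nn_integral_cmult, measurable, subst nn_integral_gauss_prod_mixture) (use s in auto)
    also have "\<dots> = 1"
      using gv[of x] sv by (simp add: ennreal_mult'[symmetric])
    finally show ?thesis .
  qed
  \<comment> \<open>The Gaussian density of \<open>P\<close> cancels the denominator of
    \<open>r\<close>: given the reproduction \<open>y\<close>, the source is
    \<open>N(y, s)\<close>.\<close>
  have int_x: "(\<integral>\<^sup>+ x. h x * ennreal (r x y) \<partial>P) = (\<integral>\<^sup>+ x. h x * ennreal (gauss_prod (\<lambda>i. y $ i) s x) \<partial>lborel)"
    if [measurable]: "h \<in> borel_measurable borel" for h y
  proof -
    have "(\<integral>\<^sup>+ x. h x * ennreal (r x y) \<partial>P)
        = (\<integral>\<^sup>+ x. ennreal (gauss_prod (\<lambda>_. 0) v x) * (h x * ennreal (r x y)) \<partial>lborel)"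
      unfolding P_def by (subst nn_integral_density) auto
    also have "\<dots> = (\<integral>\<^sup>+ x. h x * ennreal (gauss_prod (\<lambda>i. y $ i) s x) \<partial>lborel)"
    proof (intro nn_integral_cong)
      fix x
      have "ennreal (gauss_prod (\<lambda>_. 0) v x) * ennreal (r x y) = ennreal (gauss_prod (\<lambda>i. y $ i) s x)"
        using gv[of x] by (simp add: r_def ennreal_mult'[symmetric])
      then show "ennreal (gauss_prod (\<lambda>_. 0) v x) * (h x * ennreal (r x y))
          = h x * ennreal (gauss_prod (\<lambda>i. y $ i) s x)"
        by (metis mult.left_commute)
    qed
    finally show ?thesis .
  qed
  have K: "K \<in> borel \<rightarrow>\<^sub>M prob_algebra borel"
  proof (rule measurable_prob_algebraI)
    show "prob_space (K x)" for x
      unfolding K_def by (rule prob_spaceI) (simp add: emeasure_density r_1)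
    then have "subprob_space (K x)" for x by (rule prob_space_imp_subprob_space)
    then show "K \<in> borel \<rightarrow>\<^sub>M subprob_algebra borel"
    proof (rule measurable_subprob_algebra)
      fix A :: "(real ^ 'm) set" assume [measurable]: "A \<in> sets borel"
      have "(\<lambda>x. \<integral>\<^sup>+ y. ennreal (r x y) * indicator A y \<partial>\<nu>) \<in> borel_measurable borel"
        by measurable
      then show "(\<lambda>x. emeasure (K x) A) \<in> borel_measurable borel"
        unfolding K_def by (subst emeasure_density) auto
    qed (simp add: K_def s\<nu>)
  qed
  have nn_J: "(\<integral>\<^sup>+ z. g z \<partial>J) = (\<integral>\<^sup>+ x. \<integral>\<^sup>+ y. g (x, y) * ennreal (r x y) \<partial>\<nu> \<partial>P)"
    if [measurable]: "g \<in> borel_measurable (borel \<Otimes>\<^sub>M borel)" for g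
  proof -
    have "(\<integral>\<^sup>+ z. g z \<partial>J) = (\<integral>\<^sup>+ x. \<integral>\<^sup>+ y. g (x, y) \<partial>K x \<partial>P)"
      unfolding J_def by (rule nn_integral_joint_kernel[OF P sP K]) measurable
    also have "\<dots> = (\<integral>\<^sup>+ x. \<integral>\<^sup>+ y. g (x, y) * ennreal (r x y) \<partial>\<nu> \<partial>P)"
      unfolding K_def by (intro nn_integral_cong, subst nn_integral_density) (auto simp: mult.commute)
    finally show ?thesis .
  qed
  have sJ [measurable_cong]: "sets J = sets (borel \<Otimes>\<^sub>M borel)"
    unfolding J_def by (rule sets_joint_kernel[OF P sP K])
  have sJ': "sets J = sets (P \<Otimes>\<^sub>M \<nu>)"
    unfolding sJ by (rule sets_pair_measure_cong) (auto simp: sP s\<nu>)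
  have J_density: "J = density (P \<Otimes>\<^sub>M \<nu>) (\<lambda>z. ennreal (r (fst z) (snd z)))"
  proof (rule measure_eqI)
    fix A assume "A \<in> sets J"
    then have A [measurable]: "A \<in> sets (borel \<Otimes>\<^sub>M borel)" by (simp add: sJ)
    have "emeasure J A = (\<integral>\<^sup>+ z. indicator A z \<partial>J)" by (simp add: sJ)
    also have "\<dots> = (\<integral>\<^sup>+ x. \<integral>\<^sup>+ y. indicator A (x, y) * ennreal (r x y) \<partial>\<nu> \<partial>P)"
      by (rule nn_J) measurable
    also have "\<dots> = (\<integral>\<^sup>+ z. indicator A z * ennreal (r (fst z) (snd z)) \<partial>(P \<Otimes>\<^sub>M \<nu>))"
      by (subst \<nu>.nn_integral_fst[symmetric]) auto
    also have "\<dots> = emeasure (density (P \<Otimes>\<^sub>M \<nu>) (\<lambda>z. ennreal (r (fst z) (snd z)))) A"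
      by (subst emeasure_density) (auto simp: mult.commute)
    finally show "emeasure J A = emeasure (density (P \<Otimes>\<^sub>M \<nu>) (\<lambda>z. ennreal (r (fst z) (snd z)))) A" .
  qed (simp add: sJ')
  \<comment> \<open>Exchanging the order of integration gives the backward description, reproduction
    first and then source, from which the second marginal and the distortion are read off.\<close>
  have nn_J': "(\<integral>\<^sup>+ z. g z \<partial>J)
      = (\<integral>\<^sup>+ y. \<integral>\<^sup>+ x. g (x, y) * ennreal (gauss_prod (\<lambda>i. y $ i) s x) \<partial>lborel \<partial>\<nu>)"
    if [measurable]: "g \<in> borel_measurable (borel \<Otimes>\<^sub>M borel)" for g
  proof -
    have "(\<integral>\<^sup>+ z. g z \<partial>J) = (\<integral>\<^sup>+ z. g z * ennreal (r (fst z) (snd z)) \<partial>(P \<Otimes>\<^sub>M \<nu>))"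
      unfolding J_density by (subst nn_integral_density) (auto simp: mult.commute)
    also have "\<dots> = (\<integral>\<^sup>+ y. \<integral>\<^sup>+ x. g (x, y) * ennreal (r x y) \<partial>P \<partial>\<nu>)"
      by (subst PN.nn_integral_snd[symmetric]) auto
    also have "\<dots> = (\<integral>\<^sup>+ y. \<integral>\<^sup>+ x. g (x, y) * ennreal (gauss_prod (\<lambda>i. y $ i) s x) \<partial>lborel \<partial>\<nu>)"
      by (intro nn_integral_cong int_x) measurable
    finally show ?thesis .
  qed
  have fstJ: "distr J borel fst = P" unfolding J_def by (rule distr_joint_kernel_fst[OF P sP K])
  have sndJ: "distr J borel snd = \<nu>"
  proof (rule measure_eqI)
    fix A assume "A \<in> sets (distr J borel snd)"
    then have A [measurable]: "A \<in> sets borel" by simp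
    have "emeasure (distr J borel snd) A = (\<integral>\<^sup>+ z. indicator A (snd z) \<partial>J)"
      using nn_integral_distr[of snd J borel "indicator A"] by simp
    also have "\<dots> = (\<integral>\<^sup>+ y. \<integral>\<^sup>+ x. indicator A y * ennreal (gauss_prod (\<lambda>i. y $ i) s x) \<partial>lborel \<partial>\<nu>)"
      by (subst nn_J') auto
    also have "\<dots> = (\<integral>\<^sup>+ y. indicator A y \<partial>\<nu>)"
      by (intro nn_integral_cong, subst nn_integral_cmult) (auto simp: nn_integral_gauss_prod[OF s])
    also have "\<dots> = emeasure \<nu> A" by (simp add: s\<nu>)
    finally show "emeasure (distr J borel snd) A = emeasure \<nu> A" .
  qed (simp add: s\<nu>)
  have J: "prob_space J" unfolding J_def by (rule prob_space_joint_kernel[OF P sP K])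
  interpret J: prob_space J by fact
  have mom_d: "(\<integral>\<^sup>+ z. ennreal ((fst z $ i - snd z $ i)\<^sup>2) \<partial>J) = ennreal (s i)" for i
  proof -
    have "(\<integral>\<^sup>+ z. ennreal ((fst z $ i - snd z $ i)\<^sup>2) \<partial>J)
        = (\<integral>\<^sup>+ y. \<integral>\<^sup>+ x. ennreal ((x $ i - y $ i)\<^sup>2) * ennreal (gauss_prod (\<lambda>i. y $ i) s x) \<partial>lborel \<partial>\<nu>)"
      by (subst nn_J') auto
    also have "\<dots> = (\<integral>\<^sup>+ y. ennreal (s i) \<partial>\<nu>)"
      using nn_integral_gauss_prod_second_moment[OF s, where i = i]
      by (intro nn_integral_cong) (simp add: ennreal_mult'[symmetric])
    finally show ?thesis by (simp add: \<nu>.emeasure_space_1)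
  qed
  have mom_x: "(\<integral>\<^sup>+ z. ennreal ((fst z $ i)\<^sup>2) \<partial>J) = ennreal (v i)" for i
  proof -
    have "(\<integral>\<^sup>+ z. ennreal ((fst z $ i)\<^sup>2) \<partial>J) = (\<integral>\<^sup>+ x. ennreal ((x $ i)\<^sup>2) \<partial>distr J borel fst)"
      by (subst nn_integral_distr) auto
    also have "\<dots> = ennreal (v i)"
      unfolding fstJ P_def by (rule second_moment_gauss_prod_measure[OF v])
    finally show ?thesis .
  qed
  have int_d: "integrable J (\<lambda>z. (fst z $ i - snd z $ i)\<^sup>2)" for i
    by (rule integrableI_nn_integral_finite[OF _ _ mom_d]) auto
  have E_d: "(\<integral>z. (fst z $ i - snd z $ i)\<^sup>2 \<partial>J) = s i" for i
    using mom_d[of i] s[of i] by (subst (asm) nn_integral_eq_integral[OF int_d]) auto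
  have int_x2: "integrable J (\<lambda>z. (fst z $ i)\<^sup>2)" for i
    by (rule integrableI_nn_integral_finite[OF _ _ mom_x]) auto
  have E_x2: "(\<integral>z. (fst z $ i)\<^sup>2 \<partial>J) = v i" for i
    using mom_x[of i] v[of i] by (subst (asm) nn_integral_eq_integral[OF int_x2]) auto
  have log_r: "log 2 (r (fst z) (snd z)) = (\<Sum>i\<in>UNIV. ln (v i / s i) / 2
      - (fst z $ i - snd z $ i)\<^sup>2 / (2 * s i) + (fst z $ i)\<^sup>2 / (2 * v i)) / ln 2" for z
    unfolding r_def log_def by (subst ln_gauss_prod_ratio[OF s v]) simp
  have int_log: "integrable J (\<lambda>z. log 2 (r (fst z) (snd z)))"
    unfolding log_r using int_d int_x2 by auto
  \<comment> \<open>The two quadratic terms have means \<open>1 / 2\<close> in every coordinate and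
    opposite signs, so only the logarithms survive.\<close>
  have "(\<integral>z. log 2 (r (fst z) (snd z)) \<partial>J)
      = (\<Sum>i\<in>UNIV. ln (v i / s i) / 2 - s i / (2 * s i) + v i / (2 * v i)) / ln 2"
    unfolding log_r using int_d int_x2 by (simp add: E_d E_x2 J.prob_space)
  also have "\<dots> = (\<Sum>i\<in>UNIV. log 2 (v i / s i) / 2)"
    using less_imp_neq[OF s] less_imp_neq[OF v]
    by (simp add: log_def sum_divide_distrib mult.commute)
  finally have E_log: "(\<integral>z. log 2 (r (fst z) (snd z)) \<partial>J) = (\<Sum>i\<in>UNIV. log 2 (v i / s i) / 2)" .
  have "MI_joint J borel borel = KL2 J (P \<Otimes>\<^sub>M \<nu>)"
    by (simp add: MI_joint_def fstJ sndJ)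
  also have "\<dots> = ereal (\<integral>z. log 2 (r (fst z) (snd z)) \<partial>J)"
    using int_log r0 unfolding J_density by (intro KL2_density) (auto intro: PN.sigma_finite_measure_axioms)
  finally have MI: "MI_joint J borel borel = ereal (\<Sum>i\<in>UNIV. log 2 (v i / s i) / 2)"
    unfolding E_log .
  have "(\<integral>\<^sup>+ z. ennreal ((norm (fst z - snd z))\<^sup>2) \<partial>J)
      = (\<integral>\<^sup>+ z. (\<Sum>i\<in>UNIV. ennreal ((fst z $ i - snd z $ i)\<^sup>2)) \<partial>J)"
    by (simp add: norm_power2_vec sum_ennreal)
  also have "\<dots> = (\<Sum>i\<in>UNIV. ennreal (s i))"
    by (subst nn_integral_sum) (auto simp: mom_d)
  also have "\<dots> = ennreal (\<Sum>i\<in>UNIV. s i)"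
    using s by (simp add: sum_ennreal less_imp_le)
  finally have dist: "(\<integral>\<^sup>+ z. ennreal ((norm (fst z - snd z))\<^sup>2) \<partial>J) = ennreal (\<Sum>i\<in>UNIV. s i)" .
  have "rate_distortion P (\<Sum>i\<in>UNIV. s i) \<le> MI_joint (joint_kernel P K) borel borel"
    unfolding rate_distortion_def by (rule INF_lower) (use K dist in \<open>simp add: J_def\<close>)
  then show ?thesis by (simp only: J_def[symmetric] MI P_def[symmetric])
qed

section \<open>Information through the Gaussian channel\<close>

text \<open>A diagonal affine map has constant Jacobian, the product of the absolute scale factors.
  As in Tonelli above, the factors are re-indexed from coordinates to \<open>Basis\<close>.\<close>

lemma nn_integral_lborel_vec_affine:
  fixes t c :: "'m::finite \<Rightarrow> real" and f :: "real ^ 'm \<Rightarrow> ennreal"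
  assumes c: "\<And>i. c i \<noteq> 0" and [measurable]: "f \<in> borel_measurable borel"
  shows "(\<integral>\<^sup>+ z. f z \<partial>lborel) = (\<integral>\<^sup>+ u. ennreal (\<Prod>i\<in>UNIV. \<bar>c i\<bar>) * f (\<chi> i. t i + c i * u $ i) \<partial>lborel)"
proof -
  define C where "C b = c (SOME i. b = axis i (1::real))" for b
  have C: "C (axis i 1) = c i" for i
    by (simp add: C_def axis_eq_axis)
  have Basis: "(Basis :: (real ^ 'm) set) = (\<lambda>i. axis i 1) ` UNIV"
    by (auto simp: Basis_vec_def)
  have inj: "inj_on (\<lambda>i::'m. axis i (1::real)) UNIV"
    by (auto intro!: injI simp: axis_eq_axis)
  define T where "T u = (\<chi> i. t i) + (\<Sum>b\<in>Basis. (C b * (u \<bullet> b)) *\<^sub>R b)" for u :: "real ^ 'm"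
  have T: "T u = (\<chi> i. t i + c i * u $ i)" for u
  proof -
    have "(\<Sum>i\<in>UNIV. c i * u $ i * axis i 1 $ j) = c j * u $ j" for j
      by (simp add: axis_def if_distrib[of "(*) _"] cong: if_cong)
    then show ?thesis
      by (simp add: T_def vec_eq_iff Basis sum.reindex[OF inj] C inner_axis)
  qed
  have [measurable]: "T \<in> borel \<rightarrow>\<^sub>M borel" unfolding T by measurable
  have "lborel = density (distr lborel borel T) (\<lambda>_. \<Prod>b\<in>Basis. \<bar>C b\<bar>)"
    unfolding T_def by (rule lborel_affine_euclidean) (auto simp: C_def c)
  then have eq: "lborel = density (distr lborel borel T) (\<lambda>_. \<Prod>i\<in>UNIV. \<bar>c i\<bar>)"
    by (simp add: Basis prod.reindex[OF inj] C)
  show ?thesis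
    unfolding T[symmetric]
    by (subst (1) eq) (simp add: nn_integral_density nn_integral_distr)
qed

text \<open>For fixed \<open>x\<close>, substituting the output for the noise \<open>u\<close> turns
  the standard normal density into that of \<open>N(a x, s)\<close>. Taking densities relative to
  \<open>P \<Otimes>\<^sub>M lborel\<close> leaves the input law arbitrary.\<close>

lemma distr_gaussian_channel:
  fixes a s :: "'m::finite \<Rightarrow> real"
  assumes P: "prob_space P" and sP [measurable_cong]: "sets P = sets borel"
    and s: "\<And>i. s i > 0"
  shows "distr (P \<Otimes>\<^sub>M density lborel (\<lambda>u. ennreal (gauss_prod (\<lambda>_. 0) (\<lambda>_. 1) u))) (borel \<Otimes>\<^sub>M borel)
      (\<lambda>(x, u). (x, \<chi> i. a i * x $ i + sqrt (s i) * u $ i))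
    = density (P \<Otimes>\<^sub>M lborel) (\<lambda>w. ennreal (gauss_prod (\<lambda>i. a i * fst w $ i) s (snd w)))"
    (is "distr (P \<Otimes>\<^sub>M ?G) _ ?F = ?R")
proof (rule measure_eqI)
  have G: "prob_space ?G" by (rule prob_space_gauss_prod) simp
  interpret P: prob_space P by fact
  interpret G: prob_space ?G by fact
  have sets: "sets (P \<Otimes>\<^sub>M lborel) = sets (borel \<Otimes>\<^sub>M borel)"
    by (rule sets_pair_measure_cong) (auto simp: sP)
  from this[symmetric] show "sets (distr (P \<Otimes>\<^sub>M ?G) (borel \<Otimes>\<^sub>M borel) ?F) = sets ?R"
    unfolding sets_distr sets_density .
  fix A assume "A \<in> sets (distr (P \<Otimes>\<^sub>M ?G) (borel \<Otimes>\<^sub>M borel) ?F)"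
  then have A [measurable]: "A \<in> sets (borel \<Otimes>\<^sub>M borel)" by simp
  define g where "g = gauss_prod (\<lambda>_::'m. 0) (\<lambda>_. 1)"
  define k where "k x z = gauss_prod (\<lambda>i. a i * x $ i) s z" for x z :: "real ^ 'm"
  define T where "T x u = (\<chi> i. a i * x $ i + sqrt (s i) * u $ i)" for x u :: "real ^ 'm"
  have [measurable]: "(\<lambda>w. T (fst w) (snd w)) \<in> borel \<Otimes>\<^sub>M borel \<rightarrow>\<^sub>M borel" "T x \<in> borel \<rightarrow>\<^sub>M borel" for x
    unfolding T_def by measurable
  have [measurable]: "(\<lambda>w. k (fst w) (snd w)) \<in> borel_measurable (borel \<Otimes>\<^sub>M borel)"
      "k x \<in> borel_measurable borel" for x
    unfolding k_def by measurable
  have [measurable]: "g \<in> borel_measurable borel" unfolding g_def by measurable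
  have jac: "(\<Prod>i\<in>UNIV. \<bar>sqrt (s i)\<bar>) * k x (T x u) = g u" for x u
  proof -
    have "sqrt (s i) * normal_density (a i * x $ i) (sqrt (s i)) (a i * x $ i + sqrt (s i) * u $ i)
        = std_normal_density (u $ i)" for i
      using s[of i] by (simp add: normal_density_def real_sqrt_mult power_mult_distrib)
    then show ?thesis
      using s by (simp add: k_def T_def g_def gauss_prod_def prod.distrib[symmetric] less_imp_le)
  qed
  have F: "?F = (\<lambda>w. (fst w, T (fst w) (snd w)))" by (auto simp: T_def)
  have [measurable]: "(\<lambda>w. (fst w, T (fst w) (snd w))) \<in> P \<Otimes>\<^sub>M ?G \<rightarrow>\<^sub>M borel \<Otimes>\<^sub>M borel"
    by measurable
  have "emeasure (distr (P \<Otimes>\<^sub>M ?G) (borel \<Otimes>\<^sub>M borel) ?F) A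
      = (\<integral>\<^sup>+ w. indicator A (fst w, T (fst w) (snd w)) \<partial>(P \<Otimes>\<^sub>M ?G))"
    unfolding F
    using nn_integral_distr[of "\<lambda>w. (fst w, T (fst w) (snd w))" "P \<Otimes>\<^sub>M ?G" "borel \<Otimes>\<^sub>M borel" "indicator A"]
    by simp
  also have "\<dots> = (\<integral>\<^sup>+ x. \<integral>\<^sup>+ u. indicator A (x, T x u) \<partial>?G \<partial>P)"
    by (subst G.nn_integral_fst[symmetric]) auto
  also have "\<dots> = (\<integral>\<^sup>+ x. \<integral>\<^sup>+ u. ennreal (g u) * indicator A (x, T x u) \<partial>lborel \<partial>P)"
    unfolding g_def by (intro nn_integral_cong, subst nn_integral_density) auto
  also have "\<dots> = (\<integral>\<^sup>+ x. \<integral>\<^sup>+ z. ennreal (k x z) * indicator A (x, z) \<partial>lborel \<partial>P)"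
  proof (rule nn_integral_cong)
    fix x
    have "(\<integral>\<^sup>+ z. ennreal (k x z) * indicator A (x, z) \<partial>lborel)
        = (\<integral>\<^sup>+ u. ennreal (\<Prod>i\<in>UNIV. \<bar>sqrt (s i)\<bar>)
          * (ennreal (k x (T x u)) * indicator A (x, T x u)) \<partial>lborel)"
      unfolding T_def by (rule nn_integral_lborel_vec_affine) (auto simp: less_imp_neq[OF s, symmetric])
    also have "\<dots> = (\<integral>\<^sup>+ u. ennreal (g u) * indicator A (x, T x u) \<partial>lborel)"
      by (intro nn_integral_cong)
        (simp add: mult.assoc[symmetric] ennreal_mult'[symmetric] k_def[symmetric] jac prod_nonneg)
    finally show "(\<integral>\<^sup>+ u. ennreal (g u) * indicator A (x, T x u) \<partial>lborel)
        = (\<integral>\<^sup>+ z. ennreal (k x z) * indicator A (x, z) \<partial>lborel)" ..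
  qed
  also have "\<dots> = (\<integral>\<^sup>+ w. ennreal (k (fst w) (snd w)) * indicator A w \<partial>(P \<Otimes>\<^sub>M lborel))"
    by (subst lborel.nn_integral_fst[symmetric]) auto
  also have "\<dots> = emeasure ?R A"
    unfolding k_def by (rule emeasure_density[symmetric]) measurable
  finally show "emeasure (distr (P \<Otimes>\<^sub>M ?G) (borel \<Otimes>\<^sub>M borel) ?F) A = emeasure ?R A" .
qed

text \<open>With \<open>k\<close> the channel density, \<open>q\<close> the output density and
  \<open>p\<close> the Gaussian one, \<open>log (k / q) = log (k / p) - log (q / p)\<close>. The
  mean of the first term depends on second moments only, and that of the second is
  \<open>KL2 N Q\<close>. A real \<open>c\<close> is produced so that later subtractions in
  \<open>ereal\<close> are harmless.\<close>

lemma gaussian_channel_information: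
  fixes a s v :: "'m::finite \<Rightarrow> real"
  assumes P: "prob_space P" and sP [measurable_cong]: "sets P = sets borel"
    and s: "\<And>i. s i > 0" and sv: "\<And>i. s i \<le> v i"
  defines "J \<equiv> density (P \<Otimes>\<^sub>M lborel) (\<lambda>w. ennreal (gauss_prod (\<lambda>i. a i * fst w $ i) s (snd w)))"
  defines "N \<equiv> distr J borel snd"
  defines "Q \<equiv> density lborel (\<lambda>z. ennreal (gauss_prod (\<lambda>_. 0) v z))"
  assumes mom: "\<And>i. (\<integral>\<^sup>+ z. ennreal ((z $ i)\<^sup>2) \<partial>N) = ennreal (v i)"
  obtains c where "KL2 N Q = ereal c" and "KL2 J (P \<Otimes>\<^sub>M N) = ereal ((\<Sum>i\<in>UNIV. log 2 (v i / s i) / 2) - c)"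
proof -
  have v: "v i > 0" for i using s[of i] sv[of i] by linarith
  interpret P: prob_space P by fact
  have PL: "pair_sigma_finite P lborel" by unfold_locales
  interpret PL: pair_sigma_finite P lborel by fact
  have Q: "prob_space Q" unfolding Q_def by (rule prob_space_gauss_prod[OF v])
  interpret Q: prob_space Q by fact
  have setsPL: "sets (P \<Otimes>\<^sub>M lborel) = sets (borel \<Otimes>\<^sub>M borel)"
    by (rule sets_pair_measure_cong) (auto simp: sP)
  have sJ [measurable_cong]: "sets J = sets (borel \<Otimes>\<^sub>M borel)"
    unfolding J_def sets_density by (rule setsPL)
  have sN [measurable_cong]: "sets N = sets borel" by (simp add: N_def)
  define k where "k x z = gauss_prod (\<lambda>i. a i * x $ i) s z" for x z :: "real ^ 'm"
  define p where "p = gauss_prod (\<lambda>_::'m. 0) v"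
  have [measurable]: "(\<lambda>w. k (fst w) (snd w)) \<in> borel_measurable (borel \<Otimes>\<^sub>M borel)"
      "k x \<in> borel_measurable borel" "(\<lambda>x. k x z) \<in> borel_measurable borel" for x z
    unfolding k_def by measurable
  have [measurable]: "p \<in> borel_measurable borel" unfolding p_def by measurable
  have k0: "k x z > 0" for x z unfolding k_def by (rule gauss_prod_pos[OF s])
  have p0: "p z > 0" for z unfolding p_def by (rule gauss_prod_pos[OF v])
  have J: "J = density (P \<Otimes>\<^sub>M lborel) (\<lambda>w. ennreal (k (fst w) (snd w)))" by (simp add: J_def k_def)
  have Qp: "Q = density lborel (\<lambda>z. ennreal (p z))" by (simp add: Q_def p_def)
  \<comment> \<open>The peak of the noise density, attained when the mean equals the output. It is
    constant in \<open>z\<close>, but writing it as a \<open>gauss_prod\<close> makes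
    \<open>ln_gauss_prod_ratio\<close> applicable to \<open>B z / p z\<close>.\<close>
  define B where "B z = gauss_prod (\<lambda>i. z $ i) s z" for z :: "real ^ 'm"
  have kB: "k x z \<le> B z" for x z
    unfolding k_def B_def gauss_prod_def using s
    by (intro prod_mono) (auto simp: normal_density_def intro!: divide_right_mono)
  \<comment> \<open>The output density as a mixture over inputs; the bound by \<open>B\<close> makes
    it finite everywhere, so \<open>enn2real\<close> loses nothing.\<close>
  define q where "q z = enn2real (\<integral>\<^sup>+ x. ennreal (k x z) \<partial>P)" for z
  have qle: "(\<integral>\<^sup>+ x. ennreal (k x z) \<partial>P) \<le> ennreal (B z)" for z
  proof -
    have "(\<integral>\<^sup>+ x. ennreal (k x z) \<partial>P) \<le> (\<integral>\<^sup>+ x. ennreal (B z) \<partial>P)"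
      by (intro nn_integral_mono ennreal_leI kB)
    then show ?thesis by (simp add: P.emeasure_space_1)
  qed
  have q_eq: "ennreal (q z) = (\<integral>\<^sup>+ x. ennreal (k x z) \<partial>P)" for z
    unfolding q_def using le_less_trans[OF qle ennreal_less_top] by simp
  have qB: "q z \<le> B z" for z
    using qle[of z] unfolding q_eq[symmetric]
    by (subst (asm) ennreal_le_iff) (auto simp: B_def gauss_prod_nonneg)
  have q0: "q z > 0" for z
  proof -
    have "(\<integral>\<^sup>+ x. ennreal (k x z) \<partial>P) \<noteq> 0"
    proof
      assume "(\<integral>\<^sup>+ x. ennreal (k x z) \<partial>P) = 0"
      then have "AE x in P. ennreal (k x z) = 0" by (subst (asm) nn_integral_0_iff_AE) auto
      then have "AE x in P. False" by eventually_elim (metis ennreal_eq_0_iff k0 not_le)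
      then show False by simp
    qed
    then show ?thesis unfolding q_eq[symmetric] by (simp add: ennreal_eq_0_iff not_le)
  qed
  have [measurable]: "q \<in> borel_measurable borel"
    unfolding q_def k_def by measurable
  have Nq: "N = density lborel (\<lambda>z. ennreal (q z))"
  proof (rule measure_eqI)
    fix A assume "A \<in> sets N"
    then have A [measurable]: "A \<in> sets borel" by (simp add: sN)
    have "emeasure N A = (\<integral>\<^sup>+ w. indicator A (snd w) \<partial>J)"
      unfolding N_def using nn_integral_distr[of snd J borel "indicator A"] by simp
    also have "\<dots> = (\<integral>\<^sup>+ w. ennreal (k (fst w) (snd w)) * indicator A (snd w) \<partial>(P \<Otimes>\<^sub>M lborel))"
      unfolding J by (subst nn_integral_density) auto
    also have "\<dots> = (\<integral>\<^sup>+ z. \<integral>\<^sup>+ x. ennreal (k x z) * indicator A z \<partial>P \<partial>lborel)"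
      by (subst PL.nn_integral_snd[symmetric]) auto
    also have "\<dots> = (\<integral>\<^sup>+ z. ennreal (q z) * indicator A z \<partial>lborel)"
      by (intro nn_integral_cong, subst nn_integral_multc) (auto simp: q_eq)
    also have "\<dots> = emeasure (density lborel (\<lambda>z. ennreal (q z))) A"
      by (subst emeasure_density) auto
    finally show "emeasure N A = emeasure (density lborel (\<lambda>z. ennreal (q z))) A" .
  qed (simp add: sN)
  have NQ: "N = density Q (\<lambda>z. ennreal (q z / p z))"
    unfolding Nq Qp using p0 q0
    by (subst density_density_eq)
      (auto intro!: density_cong AE_I2 simp: ennreal_mult'[symmetric] less_imp_le less_imp_neq[OF p0, symmetric])
  have [measurable]: "(\<lambda>w. k (fst w) (snd w)) \<in> borel_measurable (P \<Otimes>\<^sub>M lborel)" by measurable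
  have one: "(\<integral>\<^sup>+ w. ennreal (k (fst w) (snd w)) \<partial>(P \<Otimes>\<^sub>M lborel)) = 1"
    by (subst lborel.nn_integral_fst[symmetric])
      (auto simp: k_def nn_integral_gauss_prod[OF s] P.emeasure_space_1)
  have Jp: "prob_space J"
  proof (rule prob_spaceI)
    have "emeasure J (space J) = (\<integral>\<^sup>+ w. 1 \<partial>J)" by simp
    also have "\<dots> = (\<integral>\<^sup>+ w. ennreal (k (fst w) (snd w)) * 1 \<partial>(P \<Otimes>\<^sub>M lborel))"
      unfolding J by (rule nn_integral_density) measurable
    finally show "emeasure J (space J) = 1" by (simp add: one)
  qed
  interpret J: prob_space J by fact
  have Np: "prob_space N" unfolding N_def by (rule J.prob_space_distr) measurable
  interpret N: prob_space N by fact
  interpret PN: pair_prob_space P N ..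
  \<comment> \<open>Dividing by \<open>q (snd w)\<close> changes the reference measure from
    \<open>P \<Otimes>\<^sub>M lborel\<close> to the product of the marginals.\<close>
  have JPN: "J = density (P \<Otimes>\<^sub>M N) (\<lambda>w. ennreal (k (fst w) (snd w) / q (snd w)))"
  proof -
    have "P \<Otimes>\<^sub>M N = density P (\<lambda>_. 1) \<Otimes>\<^sub>M density lborel (\<lambda>z. ennreal (q z))"
      by (simp add: density_1 Nq)
    also have "\<dots> = density (P \<Otimes>\<^sub>M lborel) (\<lambda>(x, z). 1 * ennreal (q z))"
      by (rule pair_measure_density)
        (auto simp: Nq[symmetric] intro: N.sigma_finite_measure_axioms lborel.sigma_finite_measure_axioms)
    finally have "P \<Otimes>\<^sub>M N = density (P \<Otimes>\<^sub>M lborel) (\<lambda>w. ennreal (q (snd w)))"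
      by (simp add: case_prod_unfold)
    then show ?thesis
      unfolding J using q0 k0
      by (simp, subst density_density_eq)
        (auto intro!: density_cong AE_I2 simp: ennreal_mult'[symmetric] less_imp_le less_imp_neq[OF q0, symmetric])
  qed
  have int_z: "integrable N (\<lambda>z. (z $ i)\<^sup>2)" for i
    by (rule integrableI_nn_integral_finite[OF _ _ mom]) auto
  have E_z: "(\<integral>z. (z $ i)\<^sup>2 \<partial>N) = v i" for i
    using mom[of i] v[of i] by (subst (asm) nn_integral_eq_integral[OF int_z]) auto
  have sndm [measurable]: "snd \<in> J \<rightarrow>\<^sub>M borel" by measurable
  have int_z': "integrable J (\<lambda>w. (snd w $ i)\<^sup>2)" for i
    using int_z[of i] unfolding N_def by (subst (asm) integrable_distr_eq) auto
  have E_z': "(\<integral>w. (snd w $ i)\<^sup>2 \<partial>J) = v i" for i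
    using E_z[of i] unfolding N_def by (subst (asm) integral_distr) auto
  have mom_d: "(\<integral>\<^sup>+ w. ennreal ((snd w $ i - a i * fst w $ i)\<^sup>2) \<partial>J) = ennreal (s i)" for i
  proof -
    have "(\<integral>\<^sup>+ w. ennreal ((snd w $ i - a i * fst w $ i)\<^sup>2) \<partial>J)
        = (\<integral>\<^sup>+ w. ennreal (k (fst w) (snd w)) * ennreal ((snd w $ i - a i * fst w $ i)\<^sup>2) \<partial>(P \<Otimes>\<^sub>M lborel))"
      unfolding J by (subst nn_integral_density) auto
    also have "\<dots> = (\<integral>\<^sup>+ x. \<integral>\<^sup>+ z. ennreal (k x z) * ennreal ((z $ i - a i * x $ i)\<^sup>2) \<partial>lborel \<partial>P)"
      by (subst lborel.nn_integral_fst[symmetric]) auto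
    also have "\<dots> = (\<integral>\<^sup>+ x. \<integral>\<^sup>+ z. ennreal ((z $ i - a i * x $ i)\<^sup>2 * k x z) \<partial>lborel \<partial>P)"
      using k0 by (simp add: ennreal_mult'[symmetric] less_imp_le mult.commute)
    also have "\<dots> = (\<integral>\<^sup>+ x. ennreal (s i) \<partial>P)"
    proof (rule nn_integral_cong)
      fix x
      show "(\<integral>\<^sup>+ z. ennreal ((z $ i - a i * x $ i)\<^sup>2 * k x z) \<partial>lborel) = ennreal (s i)"
        unfolding k_def
        by (rule nn_integral_gauss_prod_second_moment[where m = "\<lambda>i. a i * x $ i"]) (rule s)
    qed
    finally show ?thesis by (simp add: P.emeasure_space_1)
  qed
  have int_d: "integrable J (\<lambda>w. (snd w $ i - a i * fst w $ i)\<^sup>2)" for i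
    by (rule integrableI_nn_integral_finite[OF _ _ mom_d]) auto
  have E_d: "(\<integral>w. (snd w $ i - a i * fst w $ i)\<^sup>2 \<partial>J) = s i" for i
    using mom_d[of i] s[of i] by (subst (asm) nn_integral_eq_integral[OF int_d]) auto
  \<comment> \<open>Only the positive part needs a bound: \<open>q \<le> B\<close> puts
    \<open>log 2 (q z / p z)\<close> below the quadratic \<open>h\<close>, which is integrable under
    \<open>N\<close>. \<open>integrable_log_densityI\<close> supplies the negative part.\<close>
  have int_q: "integrable N (\<lambda>z. log 2 (q z / p z))"
  proof -
    define h where "h z = (\<Sum>i\<in>UNIV. ln (v i / s i) / 2 + (z $ i)\<^sup>2 / (2 * v i)) / ln 2" for z :: "real ^ 'm"
    have h_eq: "h z = log 2 (B z / p z)" for z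
      unfolding h_def B_def p_def log_def by (subst ln_gauss_prod_ratio[OF s v]) simp
    have int_h: "integrable N h" unfolding h_def using int_z by auto
    have qh: "log 2 (q z / p z) \<le> h z" for z
      unfolding h_eq using q0[of z] p0[of z] qB[of z] by (subst log_le_cancel_iff) (auto simp: divide_right_mono)
    have "(\<integral>\<^sup>+ z. ennreal (log 2 (q z / p z)) \<partial>N) \<le> (\<integral>\<^sup>+ z. ennreal (h z) \<partial>N)"
      by (intro nn_integral_mono ennreal_leI qh)
    also have "\<dots> < \<infinity>"
      using int_h by (auto simp: real_integrable_def top.not_eq_extremum)
    finally have "(\<integral>\<^sup>+ z. ennreal (log 2 (enn2real (ennreal (q z / p z)))) \<partial>density Q (\<lambda>z. ennreal (q z / p z))) < \<infinity>"
      using q0 p0 by (simp add: NQ[symmetric] less_imp_le)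
    then have "integrable (density Q (\<lambda>z. ennreal (q z / p z))) (\<lambda>z. log 2 (enn2real (ennreal (q z / p z))))"
      by (intro integrable_log_densityI) (auto simp: Q_def intro: Q.finite_measure_axioms[unfolded Q_def])
    then show ?thesis using q0 p0 by (simp add: NQ[symmetric] less_imp_le)
  qed
  define c where "c = (\<integral>z. log 2 (q z / p z) \<partial>N)"
  have sQ [measurable_cong]: "sets Q = sets borel" by (simp add: Q_def)
  have "KL2 N Q = ereal c"
    using KL2_density[OF Q.sigma_finite_measure_axioms, of "\<lambda>z. q z / p z"] int_q q0 p0
    by (simp add: NQ[symmetric] less_imp_le c_def)
  moreover have "KL2 J (P \<Otimes>\<^sub>M N) = ereal ((\<Sum>i\<in>UNIV. log 2 (v i / s i) / 2) - c)"
  proof -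
    have log_k: "log 2 (k (fst w) (snd w) / p (snd w)) = (\<Sum>i\<in>UNIV. ln (v i / s i) / 2
        - (snd w $ i - a i * fst w $ i)\<^sup>2 / (2 * s i) + (snd w $ i)\<^sup>2 / (2 * v i)) / ln 2" for w
      unfolding k_def p_def log_def by (subst ln_gauss_prod_ratio[OF s v]) simp
    have int_k: "integrable J (\<lambda>w. log 2 (k (fst w) (snd w) / p (snd w)))"
      unfolding log_k using int_d int_z' by auto
    have "(\<integral>w. log 2 (k (fst w) (snd w) / p (snd w)) \<partial>J)
        = (\<Sum>i\<in>UNIV. ln (v i / s i) / 2 - s i / (2 * s i) + v i / (2 * v i)) / ln 2"
      unfolding log_k using int_d int_z' by (simp add: E_d E_z' J.prob_space)
    also have "\<dots> = (\<Sum>i\<in>UNIV. log 2 (v i / s i) / 2)"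
      using less_imp_neq[OF s] less_imp_neq[OF v]
      by (simp add: log_def sum_divide_distrib mult.commute)
    finally have E_k: "(\<integral>w. log 2 (k (fst w) (snd w) / p (snd w)) \<partial>J) = (\<Sum>i\<in>UNIV. log 2 (v i / s i) / 2)" .
    have int_q': "integrable J (\<lambda>w. log 2 (q (snd w) / p (snd w)))"
      using int_q unfolding N_def by (subst (asm) integrable_distr_eq) auto
    have E_q: "(\<integral>w. log 2 (q (snd w) / p (snd w)) \<partial>J) = c"
      unfolding c_def N_def by (subst integral_distr) auto
    have split: "log 2 (k (fst w) (snd w) / q (snd w))
        = log 2 (k (fst w) (snd w) / p (snd w)) - log 2 (q (snd w) / p (snd w))" for w
      using k0[of "fst w" "snd w"] q0[of "snd w"] p0[of "snd w"]
      by (simp add: log_def ln_div diff_divide_distrib)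
    have int_kq: "integrable J (\<lambda>w. log 2 (k (fst w) (snd w) / q (snd w)))"
      unfolding split using int_k int_q' by auto
    have "KL2 J (P \<Otimes>\<^sub>M N) = ereal (\<integral>w. log 2 (k (fst w) (snd w) / q (snd w)) \<partial>J)"
      using KL2_density[OF PN.sigma_finite_measure_axioms, of "\<lambda>w. k (fst w) (snd w) / q (snd w)"] int_kq q0 k0
      by (simp add: JPN[symmetric] less_imp_le)
    then show ?thesis
      unfolding split using int_k int_q' by (simp add: E_k E_q)
  qed
  ultimately show thesis by (rule that)
qed

section \<open>Conditionally independent copies\<close>

text \<open>\<open>cond_indep\<close> speaks of events, so simple functions come first. Expanding
  \<open>s\<close> into indicators, each conditional probability factors, and \<open>Y\<close> has
  the same conditional probabilities as \<open>X\<close>. The expectation becomes that of the square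
  \<open>(S w - g (Z w))^2\<close>.\<close>

lemma cond_indep_copy_simple_nonneg:
  fixes X Y :: "'w \<Rightarrow> 'a::topological_space" and Z :: "'w \<Rightarrow> 'b::topological_space"
    and s :: "'a \<Rightarrow> real" and g :: "'b \<Rightarrow> real"
  assumes "prob_space \<Omega>"
    and [measurable]: "X \<in> \<Omega> \<rightarrow>\<^sub>M borel" "Y \<in> \<Omega> \<rightarrow>\<^sub>M borel" "Z \<in> \<Omega> \<rightarrow>\<^sub>M borel"
    and ci: "cond_indep \<Omega> Z X Y"
    and joint: "distr \<Omega> (borel \<Otimes>\<^sub>M borel) (\<lambda>\<omega>. (Y \<omega>, Z \<omega>)) = distr \<Omega> (borel \<Otimes>\<^sub>M borel) (\<lambda>\<omega>. (X \<omega>, Z \<omega>))"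
    and s: "simple_function borel s"
    and [measurable]: "g \<in> borel_measurable borel" and g2: "integrable \<Omega> (\<lambda>\<omega>. (g (Z \<omega>))\<^sup>2)"
  shows "0 \<le> (\<integral>\<omega>. (s (X \<omega>) - g (Z \<omega>)) * (s (Y \<omega>) - g (Z \<omega>)) \<partial>\<Omega>)"
proof -
  interpret prob_space \<Omega> by fact
  define F where "F = vimage_algebra (space \<Omega>) Z borel"
  have sub: "subalgebra \<Omega> F"
    unfolding subalgebra_def F_def by (auto simp: sets_vimage_algebra2)
  interpret finite_measure_subalgebra \<Omega> F by unfold_locales (rule sub)
  have ZF [measurable]: "Z \<in> F \<rightarrow>\<^sub>M borel"
    unfolding F_def by (rule measurable_vimage_algebra1) auto
  define I where "I = range s"
  define A where "A c = s -` {c}" for c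
  have fin: "finite I" using s unfolding I_def simple_function_def by simp
  have A [measurable]: "A c \<in> sets borel" for c
    using measurable_sets[OF borel_measurable_simple_function[OF s], of "{c}"] by (simp add: A_def)
  have s_eq: "s x = (\<Sum>c\<in>I. c * indicator (A c) x)" for x
  proof -
    have "(\<Sum>c\<in>I. c * indicator (A c) x) = (\<Sum>c\<in>I. if c = s x then c else 0)"
      by (intro sum.cong) (auto simp: A_def)
    then show ?thesis using fin by (simp add: I_def)
  qed
  define E where "E c = (indicator {w \<in> space \<Omega>. X w \<in> A c} :: 'w \<Rightarrow> real)" for c
  define E' where "E' c = (indicator {w \<in> space \<Omega>. Y w \<in> A c} :: 'w \<Rightarrow> real)" for c
  define \<eta> where "\<eta> c = real_cond_exp \<Omega> F (E c)" for c
  have [measurable]: "E c \<in> borel_measurable \<Omega>" "E' c \<in> borel_measurable \<Omega>" for c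
    unfolding E_def E'_def by measurable
  have [measurable]: "\<eta> c \<in> borel_measurable F" "\<eta> c \<in> borel_measurable \<Omega>" for c
    unfolding \<eta>_def by (auto intro: borel_measurable_cond_exp borel_measurable_cond_exp2)
  have intE: "integrable \<Omega> (E c)" "integrable \<Omega> (E' c)" for c
    unfolding E_def E'_def by (auto intro!: integrable_const_bound[of _ 1])
  have int\<eta>: "integrable \<Omega> (\<eta> c)" for c
    unfolding \<eta>_def by (rule real_cond_exp_int(1)[OF intE(1)])
  have \<eta>_bd: "AE w in \<Omega>. \<bar>\<eta> c w\<bar> \<le> 1" for c
  proof -
    have "AE w in \<Omega>. \<eta> c w \<ge> 0" unfolding \<eta>_def
      by (rule real_cond_exp_ge_c[OF intE(1)]) (simp add: E_def)
    moreover have "AE w in \<Omega>. \<eta> c w \<le> 1" unfolding \<eta>_def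
      by (rule real_cond_exp_le_c[OF intE(1)]) (simp add: E_def indicator_le_1)
    ultimately show ?thesis by eventually_elim simp
  qed
  have copy: "AE w in \<Omega>. real_cond_exp \<Omega> F (E' c) w = \<eta> c w" for c
  proof (rule real_cond_exp_charact)
    fix B assume BF: "B \<in> sets F"
    then obtain C where C [measurable]: "C \<in> sets borel" and B: "B = Z -` C \<inter> space \<Omega>"
      unfolding F_def by (auto simp: sets_vimage_algebra2)
    have [measurable]: "B \<in> sets \<Omega>" unfolding B by measurable
    have "(\<integral>w\<in>B. E' c w \<partial>\<Omega>) = (\<integral>w. indicator (A c \<times> C) (Y w, Z w) \<partial>\<Omega>)"
      unfolding set_lebesgue_integral_def
      by (intro Bochner_Integration.integral_cong) (auto simp: E'_def B indicator_def)
    also have "\<dots> = (\<integral>z. indicator (A c \<times> C) z \<partial>distr \<Omega> (borel \<Otimes>\<^sub>M borel) (\<lambda>\<omega>. (Y \<omega>, Z \<omega>)))"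
      by (subst integral_distr) auto
    also have "\<dots> = (\<integral>w. indicator (A c \<times> C) (X w, Z w) \<partial>\<Omega>)"
      unfolding joint by (subst integral_distr) auto
    also have "\<dots> = (\<integral>w\<in>B. E c w \<partial>\<Omega>)"
      unfolding set_lebesgue_integral_def
      by (intro Bochner_Integration.integral_cong) (auto simp: E_def B indicator_def)
    also have "\<dots> = (\<integral>w\<in>B. \<eta> c w \<partial>\<Omega>)"
      unfolding \<eta>_def by (rule real_cond_exp_intA[OF intE(1) BF])
    finally show "(\<integral>w\<in>B. E' c w \<partial>\<Omega>) = (\<integral>w\<in>B. \<eta> c w \<partial>\<Omega>)" .
  qed (auto intro: intE int\<eta>)
  have int_EE: "integrable \<Omega> (\<lambda>w. E c w * E' d w)" for c d
    by (rule integrable_const_bound[of _ 1]) (auto simp: E_def E'_def indicator_def)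
  have int_\<eta>\<eta>: "integrable \<Omega> (\<lambda>w. \<eta> c w * \<eta> d w)" for c d
  proof (rule integrable_const_bound[of _ 1])
    show "AE w in \<Omega>. norm (\<eta> c w * \<eta> d w) \<le> 1"
      using \<eta>_bd[of c] \<eta>_bd[of d]
    proof eventually_elim
      case (elim w)
      then have "\<bar>\<eta> c w\<bar> * \<bar>\<eta> d w\<bar> \<le> 1 * 1" by (intro mult_mono) auto
      then show ?case by (simp add: abs_mult)
    qed
  qed simp
  \<comment> \<open>Here conditional independence enters: the conditional probability of the joint
    event is the product \<open>\<eta> c * \<eta> d\<close>, and taking expectations removes the
    conditioning.\<close>
  have EE: "(\<integral>w. E c w * E' d w \<partial>\<Omega>) = (\<integral>w. \<eta> c w * \<eta> d w \<partial>\<Omega>)" for c d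
  proof -
    let ?G = "indicator {w \<in> space \<Omega>. X w \<in> A c \<and> Y w \<in> A d} :: 'w \<Rightarrow> real"
    have G: "?G = (\<lambda>w. E c w * E' d w)" by (auto simp: E_def E'_def indicator_def fun_eq_iff)
    have "(\<integral>w. ?G w \<partial>\<Omega>) = (\<integral>w. real_cond_exp \<Omega> F ?G w \<partial>\<Omega>)"
      by (rule real_cond_exp_int(2)[symmetric]) (simp add: G int_EE)
    also have "\<dots> = (\<integral>w. \<eta> c w * \<eta> d w \<partial>\<Omega>)"
    proof (rule integral_cong_AE)
      have "AE w in \<Omega>. real_cond_exp \<Omega> F ?G w = real_cond_exp \<Omega> F (E c) w * real_cond_exp \<Omega> F (E' d) w"
        using ci A unfolding cond_indep_def F_def E_def E'_def by blast
      then show "AE w in \<Omega>. real_cond_exp \<Omega> F ?G w = \<eta> c w * \<eta> d w"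
        using copy[of d] by eventually_elim (simp add: \<eta>_def)
    qed auto
    finally show ?thesis by (simp add: G)
  qed
  have g_int: "integrable \<Omega> (\<lambda>w. g (Z w))"
    by (rule square_integrable_imp_integrable[OF _ g2]) measurable
  have int_gE: "integrable \<Omega> (\<lambda>w. g (Z w) * E c w)" "integrable \<Omega> (\<lambda>w. g (Z w) * E' c w)" for c
    by (rule Bochner_Integration.integrable_bound[OF g_int]; auto simp: E_def E'_def indicator_def)+
  have [measurable]: "(\<lambda>w. g (Z w)) \<in> borel_measurable F" by measurable
  have int_g\<eta>: "integrable \<Omega> (\<lambda>w. g (Z w) * \<eta> c w)" for c
    unfolding \<eta>_def by (rule real_cond_exp_intg(1)[OF int_gE(1)]) auto
  have gE: "(\<integral>w. g (Z w) * E c w \<partial>\<Omega>) = (\<integral>w. g (Z w) * \<eta> c w \<partial>\<Omega>)" for c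
    unfolding \<eta>_def by (rule real_cond_exp_intg(2)[OF int_gE(1), symmetric]) auto
  have gE': "(\<integral>w. g (Z w) * E' c w \<partial>\<Omega>) = (\<integral>w. g (Z w) * \<eta> c w \<partial>\<Omega>)" for c
  proof -
    have "(\<integral>w. g (Z w) * E' c w \<partial>\<Omega>) = (\<integral>w. g (Z w) * real_cond_exp \<Omega> F (E' c) w \<partial>\<Omega>)"
      by (rule real_cond_exp_intg(2)[OF int_gE(2), symmetric]) auto
    also have "\<dots> = (\<integral>w. g (Z w) * \<eta> c w \<partial>\<Omega>)"
      by (rule integral_cong_AE) (use copy[of c] in auto)
    finally show ?thesis .
  qed
  \<comment> \<open>A version of the conditional expectation of \<open>s (X w)\<close> given
    \<open>Z\<close>; by \<open>copy\<close> it serves for \<open>Y\<close> as well.\<close>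
  define S where "S w = (\<Sum>c\<in>I. c * \<eta> c w)" for w
  have sX: "s (X w) = (\<Sum>c\<in>I. c * E c w)" if "w \<in> space \<Omega>" for w
    unfolding s_eq using that by (intro sum.cong) (auto simp: E_def indicator_def)
  have sY: "s (Y w) = (\<Sum>c\<in>I. c * E' c w)" if "w \<in> space \<Omega>" for w
    unfolding s_eq using that by (intro sum.cong) (auto simp: E'_def indicator_def)
  have "(\<integral>w. (s (X w) - g (Z w)) * (s (Y w) - g (Z w)) \<partial>\<Omega>)
      = (\<integral>w. (\<Sum>c\<in>I. \<Sum>d\<in>I. c * d * (E c w * E' d w)) - (\<Sum>c\<in>I. c * (g (Z w) * E c w))
        - (\<Sum>c\<in>I. c * (g (Z w) * E' c w)) + (g (Z w))\<^sup>2 \<partial>\<Omega>)"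
  proof (intro Bochner_Integration.integral_cong refl)
    fix w assume w: "w \<in> space \<Omega>"
    have "(\<Sum>c\<in>I. \<Sum>d\<in>I. c * d * (E c w * E' d w)) = s (X w) * s (Y w)"
      unfolding sX[OF w] sY[OF w] sum_product by (simp add: ac_simps)
    moreover have "(\<Sum>c\<in>I. c * (g (Z w) * E c w)) = g (Z w) * s (X w)"
      unfolding sX[OF w] sum_distrib_left by (simp add: ac_simps)
    moreover have "(\<Sum>c\<in>I. c * (g (Z w) * E' c w)) = g (Z w) * s (Y w)"
      unfolding sY[OF w] sum_distrib_left by (simp add: ac_simps)
    ultimately show "(s (X w) - g (Z w)) * (s (Y w) - g (Z w))
        = (\<Sum>c\<in>I. \<Sum>d\<in>I. c * d * (E c w * E' d w)) - (\<Sum>c\<in>I. c * (g (Z w) * E c w))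
          - (\<Sum>c\<in>I. c * (g (Z w) * E' c w)) + (g (Z w))\<^sup>2"
      by (simp add: algebra_simps power2_eq_square)
  qed
  also have "\<dots> = (\<Sum>c\<in>I. \<Sum>d\<in>I. c * d * (\<integral>w. \<eta> c w * \<eta> d w \<partial>\<Omega>))
      - (\<Sum>c\<in>I. c * (\<integral>w. g (Z w) * \<eta> c w \<partial>\<Omega>)) - (\<Sum>c\<in>I. c * (\<integral>w. g (Z w) * \<eta> c w \<partial>\<Omega>))
      + (\<integral>w. (g (Z w))\<^sup>2 \<partial>\<Omega>)"
    using int_EE int_gE g2 by (simp add: EE gE gE')
  also have "\<dots> = (\<integral>w. (\<Sum>c\<in>I. \<Sum>d\<in>I. c * d * (\<eta> c w * \<eta> d w)) - (\<Sum>c\<in>I. c * (g (Z w) * \<eta> c w))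
        - (\<Sum>c\<in>I. c * (g (Z w) * \<eta> c w)) + (g (Z w))\<^sup>2 \<partial>\<Omega>)"
    using int_\<eta>\<eta> int_g\<eta> g2 by simp
  also have "\<dots> = (\<integral>w. (S w - g (Z w))\<^sup>2 \<partial>\<Omega>)"
  proof (intro Bochner_Integration.integral_cong refl)
    fix w
    have "(\<Sum>c\<in>I. \<Sum>d\<in>I. c * d * (\<eta> c w * \<eta> d w)) = S w * S w"
      unfolding S_def sum_product by (simp add: ac_simps)
    moreover have "(\<Sum>c\<in>I. c * (g (Z w) * \<eta> c w)) = g (Z w) * S w"
      unfolding S_def sum_distrib_left by (simp add: ac_simps)
    ultimately show "(\<Sum>c\<in>I. \<Sum>d\<in>I. c * d * (\<eta> c w * \<eta> d w)) - (\<Sum>c\<in>I. c * (g (Z w) * \<eta> c w))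
        - (\<Sum>c\<in>I. c * (g (Z w) * \<eta> c w)) + (g (Z w))\<^sup>2 = (S w - g (Z w))\<^sup>2"
      by (simp add: algebra_simps power2_eq_square)
  qed
  also have "\<dots> \<ge> 0" by simp
  finally show ?thesis .
qed

text \<open>By conditional independence the expectation equals \<open>E[(E[f X | Z] - g Z)\<^sup>2]\<close>.\<close>

lemma cond_indep_copy_nonneg:
  fixes X Y :: "'w \<Rightarrow> 'a::topological_space" and Z :: "'w \<Rightarrow> 'b::topological_space"
    and f :: "'a \<Rightarrow> real" and g :: "'b \<Rightarrow> real"
  assumes "prob_space \<Omega>"
    and [measurable]: "X \<in> \<Omega> \<rightarrow>\<^sub>M borel" "Y \<in> \<Omega> \<rightarrow>\<^sub>M borel" "Z \<in> \<Omega> \<rightarrow>\<^sub>M borel"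
    and ci: "cond_indep \<Omega> Z X Y"
    and joint: "distr \<Omega> (borel \<Otimes>\<^sub>M borel) (\<lambda>\<omega>. (Y \<omega>, Z \<omega>)) = distr \<Omega> (borel \<Otimes>\<^sub>M borel) (\<lambda>\<omega>. (X \<omega>, Z \<omega>))"
    and [measurable]: "f \<in> borel_measurable borel" "g \<in> borel_measurable borel"
    and fX: "integrable \<Omega> (\<lambda>\<omega>. (f (X \<omega>))\<^sup>2)" and fY: "integrable \<Omega> (\<lambda>\<omega>. (f (Y \<omega>))\<^sup>2)"
    and gZ: "integrable \<Omega> (\<lambda>\<omega>. (g (Z \<omega>))\<^sup>2)"
  shows "0 \<le> (\<integral>\<omega>. (f (X \<omega>) - g (Z \<omega>)) * (f (Y \<omega>) - g (Z \<omega>)) \<partial>\<Omega>)"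
proof -
  obtain s where s: "\<And>n. simple_function borel (s n)" and lim: "\<And>x. (\<lambda>n. s n x) \<longlonglongrightarrow> f x"
    and bd: "\<And>n x. \<bar>s n x\<bar> \<le> 2 * \<bar>f x\<bar>"
    using borel_measurable_implies_sequence_metric[of f borel 0] by (auto simp: dist_real_def)
  have [measurable]: "s n \<in> borel_measurable borel" for n
    by (rule borel_measurable_simple_function[OF s])
  have "(\<lambda>n. \<integral>\<omega>. (s n (X \<omega>) - g (Z \<omega>)) * (s n (Y \<omega>) - g (Z \<omega>)) \<partial>\<Omega>)
      \<longlonglongrightarrow> (\<integral>\<omega>. (f (X \<omega>) - g (Z \<omega>)) * (f (Y \<omega>) - g (Z \<omega>)) \<partial>\<Omega>)"
  proof (rule integral_dominated_convergence)
    \<comment> \<open>The approximants satisfy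
      \<open>\<bar>s n x\<bar> \<le> 2 * \<bar>f x\<bar>\<close>, so each squared factor is at most
      \<open>8 * (f x)^2 + 2 * r^2\<close>; averaging the two bounds gives the coefficients 4, 4 and
      2.\<close>
    show "integrable \<Omega> (\<lambda>\<omega>. 4 * (f (X \<omega>))\<^sup>2 + 4 * (f (Y \<omega>))\<^sup>2 + 2 * (g (Z \<omega>))\<^sup>2)"
      using fX fY gZ by auto
    show "AE \<omega> in \<Omega>. (\<lambda>n. (s n (X \<omega>) - g (Z \<omega>)) * (s n (Y \<omega>) - g (Z \<omega>)))
        \<longlonglongrightarrow> (f (X \<omega>) - g (Z \<omega>)) * (f (Y \<omega>) - g (Z \<omega>))"
      by (intro AE_I2 tendsto_intros lim)
    fix n
    show "AE \<omega> in \<Omega>. norm ((s n (X \<omega>) - g (Z \<omega>)) * (s n (Y \<omega>) - g (Z \<omega>)))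
        \<le> 4 * (f (X \<omega>))\<^sup>2 + 4 * (f (Y \<omega>))\<^sup>2 + 2 * (g (Z \<omega>))\<^sup>2"
    proof (rule AE_I2)
      fix \<omega>
      have sq: "(s n x - r)\<^sup>2 \<le> 8 * (f x)\<^sup>2 + 2 * r\<^sup>2" for x r
      proof -
        have "(s n x)\<^sup>2 \<le> (2 * \<bar>f x\<bar>)\<^sup>2"
          using bd[of n x] by (metis abs_ge_zero power2_abs power_mono)
        moreover have "(s n x - r)\<^sup>2 \<le> 2 * (s n x)\<^sup>2 + 2 * r\<^sup>2"
          using zero_le_power2[of "s n x + r"] by (simp add: power2_sum power2_diff)
        ultimately show ?thesis by (simp add: power_mult_distrib)
      qed
      have am: "\<bar>a * b\<bar> \<le> (a\<^sup>2 + b\<^sup>2) / 2" for a b :: real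
        using zero_le_power2[of "\<bar>a\<bar> - \<bar>b\<bar>"] by (simp add: power2_diff abs_mult)
      show "norm ((s n (X \<omega>) - g (Z \<omega>)) * (s n (Y \<omega>) - g (Z \<omega>)))
          \<le> 4 * (f (X \<omega>))\<^sup>2 + 4 * (f (Y \<omega>))\<^sup>2 + 2 * (g (Z \<omega>))\<^sup>2"
        using am[of "s n (X \<omega>) - g (Z \<omega>)" "s n (Y \<omega>) - g (Z \<omega>)"]
          sq[of "X \<omega>" "g (Z \<omega>)"] sq[of "Y \<omega>" "g (Z \<omega>)"] by simp
    qed
  qed auto
  then show ?thesis
    by (rule LIMSEQ_le_const)
      (auto intro!: cond_indep_copy_simple_nonneg[OF assms(1-4) ci joint s _ gZ])
qed

section \<open>Reverse water-filling and the theorem\<close>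

text \<open>Intermediate value theorem: the total is continuous in the level, vanishes at level 0
  and reaches the sum of all \<open>v i\<close> when the level equals that sum. Positivity of
  \<open>\<Delta>\<close> rules out level 0.\<close>

lemma waterfilling_level_exists:
  fixes v :: "'m::finite \<Rightarrow> real"
  assumes v: "\<And>i. v i > 0" and \<Delta>: "0 < \<Delta>" "\<Delta> \<le> (\<Sum>i\<in>UNIV. v i)"
  obtains \<theta> where "\<theta> > 0" "(\<Sum>i\<in>UNIV. min (v i) \<theta>) = \<Delta>"
proof -
  define h where "h t = (\<Sum>i\<in>UNIV. min (v i) t)" for t
  have h0: "h 0 = 0" using v by (simp add: h_def min_absorb2 less_imp_le)
  have "v i \<le> (\<Sum>i\<in>UNIV. v i)" for i
    using v by (intro member_le_sum) (auto simp: less_imp_le)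
  then have h1: "h (\<Sum>i\<in>UNIV. v i) = (\<Sum>i\<in>UNIV. v i)" by (simp add: h_def min_absorb1)
  have "\<exists>t. 0 \<le> t \<and> t \<le> (\<Sum>i\<in>UNIV. v i) \<and> h t = \<Delta>"
    by (rule IVT') (use h0 h1 \<Delta> in \<open>auto simp: h_def intro!: continuous_intros\<close>)
  then obtain t where t: "0 \<le> t" "h t = \<Delta>" by blast
  with h0 \<Delta> have "t > 0" by (cases "t = 0") auto
  with t show thesis using that by (simp add: h_def)
qed

text \<open>For \<open>\<Delta> > 0\<close> both bounds meet at the level whose total is exactly
  \<open>\<Delta>\<close>: the test channel bounds the left side from above, the dual bound the
  right side from below, by the same number. No positive level has total 0, so
  \<open>\<Delta> = 0\<close> is treated by shrinking levels.\<close>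

lemma rate_distortion_gauss_prod_le_plus_KL2:
  fixes P :: "(real ^ 'm) measure" and v :: "'m \<Rightarrow> real"
  defines "Q \<equiv> density lborel (\<lambda>x. ennreal (gauss_prod (\<lambda>_. 0) v x))"
  assumes P: "prob_space P" and sP: "sets P = sets borel"
    and v: "\<And>i. v i > 0"
    and mom: "\<And>i. (\<integral>\<^sup>+ x. ennreal ((x $ i)\<^sup>2) \<partial>P) = ennreal (v i)"
    and \<Delta>: "0 \<le> \<Delta>" "\<Delta> \<le> (\<Sum>i\<in>UNIV. v i)"
  shows "rate_distortion Q \<Delta> \<le> rate_distortion P \<Delta> + KL2 P Q"
proof (cases "\<Delta> = 0")
  case True
  have "ereal B \<le> rate_distortion P \<Delta> + KL2 P Q" for B
  proof -
    fix i0 :: 'm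
    \<comment> \<open>Chosen so that coordinate \<open>i0\<close> alone contributes
      \<open>log 2 (2 powr (2 * \<bar>B\<bar>)) / 2 = \<bar>B\<bar>\<close>; the other contributions
      are nonnegative. Thus the right-hand side exceeds every real.\<close>
    define \<theta> where "\<theta> = v i0 * 2 powr (- (2 * \<bar>B\<bar>))"
    have \<theta>: "\<theta> > 0" using v by (simp add: \<theta>_def)
    have nn: "0 \<le> log 2 (v i / min (v i) \<theta>) / 2" for i
      using v[of i] \<theta> by (simp add: le_divide_eq)
    have "2 powr (- (2 * \<bar>B\<bar>)) \<le> 2 powr 0" by (intro powr_mono) auto
    then have "\<theta> \<le> v i0" unfolding \<theta>_def using v[of i0] by (simp add: mult_le_cancel_left2)
    then have "\<bar>B\<bar> = log 2 (v i0 / min (v i0) \<theta>) / 2"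
      using v[of i0] by (simp add: min_absorb2) (simp add: \<theta>_def powr_minus log_powr field_simps)
    also have "\<dots> \<le> (\<Sum>i\<in>UNIV. log 2 (v i / min (v i) \<theta>) / 2)"
      by (intro member_le_sum nn) auto
    finally have "ereal B \<le> ereal (\<Sum>i\<in>UNIV. log 2 (v i / min (v i) \<theta>) / 2)" by simp
    also have "\<dots> \<le> rate_distortion P \<Delta> + KL2 P Q"
      unfolding Q_def using True v \<theta>
      by (intro rate_distortion_plus_KL2_ge[OF P sP v \<theta> mom]) (auto intro!: sum_nonneg simp: less_imp_le)
    finally show ?thesis .
  qed
  then have "rate_distortion P \<Delta> + KL2 P Q = \<infinity>" by (rule ereal_top)
  then show ?thesis by (simp only: ereal_less_eq(1))
next
  case False
  then obtain \<theta> where \<theta>: "\<theta> > 0" "(\<Sum>i\<in>UNIV. min (v i) \<theta>) = \<Delta>"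
    using waterfilling_level_exists[of v \<Delta>] v \<Delta> by auto
  have "rate_distortion Q \<Delta> \<le> ereal (\<Sum>i\<in>UNIV. log 2 (v i / min (v i) \<theta>) / 2)"
    unfolding Q_def \<theta>(2)[symmetric] using v \<theta>(1) by (intro rate_distortion_gauss_prod_le) auto
  also have "\<dots> \<le> rate_distortion P \<Delta> + KL2 P Q"
    unfolding Q_def using \<theta> by (intro rate_distortion_plus_KL2_ge[OF P sP v _ mom]) auto
  finally show ?thesis .
qed

text \<open>Integrating the source out of the joint channel density gives a Gaussian mixture whose
  variances add. This identifies the law of \<open>Z\<close> with Gaussian input.\<close>

lemma distr_gaussian_channel_gauss_prod:
  fixes a s v :: "'m::finite \<Rightarrow> real"
  assumes s: "\<And>i. s i > 0" and v: "\<And>i. v i > 0"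
  shows "distr (density lborel (\<lambda>x. ennreal (gauss_prod (\<lambda>_. 0) v x))
        \<Otimes>\<^sub>M density lborel (\<lambda>u. ennreal (gauss_prod (\<lambda>_. 0) (\<lambda>_. 1) u))) borel
      (\<lambda>(x, u). \<chi> i. a i * x $ i + sqrt (s i) * u $ i)
    = density lborel (\<lambda>z. ennreal (gauss_prod (\<lambda>_. 0) (\<lambda>i. (a i)\<^sup>2 * v i + s i) z))"
    (is "distr (?P \<Otimes>\<^sub>M ?G) borel ?T = ?R")
proof (rule measure_eqI)
  have P: "prob_space ?P" by (rule prob_space_gauss_prod[OF v])
  interpret P: prob_space ?P by fact
  interpret PL: pair_sigma_finite ?P lborel by unfold_locales
  fix A assume "A \<in> sets (distr (?P \<Otimes>\<^sub>M ?G) borel ?T)"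
  then have A [measurable]: "A \<in> sets borel" by simp
  let ?F = "\<lambda>(x, u). (x, \<chi> i. a i * x $ i + sqrt (s i) * u $ i)"
  let ?k = "\<lambda>w. ennreal (gauss_prod (\<lambda>i. a i * fst w $ i) s (snd w))"
  have [measurable]: "?T \<in> ?P \<Otimes>\<^sub>M ?G \<rightarrow>\<^sub>M borel" by (simp add: case_prod_unfold)
  have [measurable]: "?F \<in> ?P \<Otimes>\<^sub>M ?G \<rightarrow>\<^sub>M borel \<Otimes>\<^sub>M borel" by (simp add: case_prod_unfold)
  have "emeasure (distr (?P \<Otimes>\<^sub>M ?G) borel ?T) A = (\<integral>\<^sup>+ w. indicator A (?T w) \<partial>(?P \<Otimes>\<^sub>M ?G))"
    using nn_integral_distr[of ?T "?P \<Otimes>\<^sub>M ?G" borel "indicator A"] by simp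
  also have "\<dots> = (\<integral>\<^sup>+ w. indicator A (snd (?F w)) \<partial>(?P \<Otimes>\<^sub>M ?G))"
    by (intro nn_integral_cong) (auto split: prod.split)
  also have "\<dots> = (\<integral>\<^sup>+ w. indicator A (snd w) \<partial>distr (?P \<Otimes>\<^sub>M ?G) (borel \<Otimes>\<^sub>M borel) ?F)"
    by (rule nn_integral_distr[symmetric]) measurable
  also have "\<dots> = (\<integral>\<^sup>+ w. indicator A (snd w) \<partial>density (?P \<Otimes>\<^sub>M lborel) ?k)"
    by (subst distr_gaussian_channel[OF P _ s]) auto
  also have "\<dots> = (\<integral>\<^sup>+ w. ?k w * indicator A (snd w) \<partial>(?P \<Otimes>\<^sub>M lborel))"
    by (rule nn_integral_density) measurable
  also have "\<dots> = (\<integral>\<^sup>+ z. \<integral>\<^sup>+ x. ?k (x, z) * indicator A z \<partial>?P \<partial>lborel)"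
    by (subst PL.nn_integral_snd[symmetric]) auto
  also have "\<dots> = (\<integral>\<^sup>+ z. ennreal (gauss_prod (\<lambda>_. 0) (\<lambda>i. (a i)\<^sup>2 * v i + s i) z) * indicator A z \<partial>lborel)"
  proof (rule nn_integral_cong)
    fix z
    have "(\<integral>\<^sup>+ x. ?k (x, z) * indicator A z \<partial>?P) = (\<integral>\<^sup>+ x. ?k (x, z) \<partial>?P) * indicator A z"
      by (rule nn_integral_multc) simp
    also have "(\<integral>\<^sup>+ x. ?k (x, z) \<partial>?P)
        = (\<integral>\<^sup>+ x. ennreal (gauss_prod (\<lambda>i. a i * x $ i) s z * gauss_prod (\<lambda>_. 0) v x) \<partial>lborel)"
      by (subst nn_integral_density) (auto simp: ennreal_mult'[symmetric] gauss_prod_nonneg mult.commute)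
    also have "\<dots> = ennreal (gauss_prod (\<lambda>_. 0) (\<lambda>i. (a i)\<^sup>2 * v i + s i) z)"
      by (rule nn_integral_gauss_prod_mixture[OF s v])
    finally show "(\<integral>\<^sup>+ x. ?k (x, z) * indicator A z \<partial>?P)
        = ennreal (gauss_prod (\<lambda>_. 0) (\<lambda>i. (a i)\<^sup>2 * v i + s i) z) * indicator A z" .
  qed
  also have "\<dots> = emeasure ?R A"
    by (rule emeasure_density[symmetric]) auto
  finally show "emeasure (distr (?P \<Otimes>\<^sub>M ?G) borel ?T) A = emeasure ?R A" .
qed simp

theorem theorem1:
  fixes \<Omega> :: "'w measure"
    and X U Xh :: "'w \<Rightarrow> real ^ 'm"
    and lam :: "'m \<Rightarrow> real"
    and \<theta> :: real
  defines "\<gamma> \<equiv> (\<lambda>i. sqrt (min 1 (\<theta> / lam i)))"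
  defines "Z \<equiv> (\<lambda>\<omega>. \<chi> i. sqrt (1 - (\<gamma> i)\<^sup>2) * X \<omega> $ i + \<gamma> i * sqrt (lam i) * U \<omega> $ i)"
  defines "PXs \<equiv> gaussian_measure (mean_vec \<Omega> X) (cov_matrix \<Omega> X)"
  defines "PZs \<equiv> distr (PXs \<Otimes>\<^sub>M gaussian_measure 0 (mat 1)) borel
                    (\<lambda>(x, u). \<chi> i. sqrt (1 - (\<gamma> i)\<^sup>2) * x $ i + \<gamma> i * sqrt (lam i) * u $ i)"
  defines "D \<equiv> (\<integral>\<omega>. (norm (X \<omega> - Xh \<omega>))\<^sup>2 \<partial>\<Omega>)"
  assumes prob: "prob_space \<Omega>"
    and X_rv: "X \<in> \<Omega> \<rightarrow>\<^sub>M borel"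
    and X_ent: "finite_diff_entropy \<Omega> X"
    and X_sq: "\<And>i. integrable \<Omega> (\<lambda>\<omega>. (X \<omega> $ i)\<^sup>2)"
    and X_int: "integrable \<Omega> X"
    and X_mean: "mean_vec \<Omega> X = 0"
    and X_cov: "cov_matrix \<Omega> X = (\<chi> i j. if i = j then lam i else 0)"
    and lam_pos: "\<And>i. lam i > 0"
    and U_distr: "distributed \<Omega> lborel U (\<lambda>u. ennreal (mvn_density 0 (mat 1) u))"
    and U_indep: "prob_space.indep_var \<Omega> borel X borel U"
    and \<theta>_pos: "\<theta> > 0"
    and Xh_rv: "Xh \<in> \<Omega> \<rightarrow>\<^sub>M borel"
    and Xh_cond: "cond_indep \<Omega> Z X Xh"
    and Xh_joint: "distr \<Omega> (borel \<Otimes>\<^sub>M borel) (\<lambda>\<omega>. (Xh \<omega>, Z \<omega>))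
                 = distr \<Omega> (borel \<Otimes>\<^sub>M borel) (\<lambda>\<omega>. (X \<omega>, Z \<omega>))"
  shows "MI \<Omega> X Z \<le> rate_distortion PXs (D / 2) - KL2 (distr \<Omega> borel Z) PZs
       \<and> rate_distortion PXs (D / 2) - KL2 (distr \<Omega> borel Z) PZs
           \<le> rate_distortion (distr \<Omega> borel X) (D / 2) + KL2 (distr \<Omega> borel X) PXs
              - KL2 (distr \<Omega> borel Z) PZs"
proof -

  \<comment> \<open>Channel parameters and Gaussian reference laws\<close>
  interpret prob_space \<Omega> by fact
  note [measurable] = X_rv Xh_rv
  have U_rv [measurable]: "U \<in> \<Omega> \<rightarrow>\<^sub>M borel"
    using distributed_measurable[OF U_distr] by simp
  \<comment> \<open>\<open>s i\<close> is the noise variance of coordinate \<open>i\<close>, equal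
    to \<open>\<gamma> i ^ 2 * lam i\<close>, and also its share of the distortion at water level
    \<open>\<theta>\<close>.\<close>
  define s where "s i = min (lam i) \<theta>" for i
  define a where "a i = sqrt (1 - (\<gamma> i)\<^sup>2)" for i
  have s: "s i > 0" "s i \<le> lam i" for i using lam_pos[of i] \<theta>_pos by (auto simp: s_def)
  have \<gamma>2: "(\<gamma> i)\<^sup>2 = s i / lam i" for i
    using lam_pos[of i] \<theta>_pos unfolding \<gamma>_def s_def by (auto simp: min_def field_simps)
  have \<gamma>s: "\<gamma> i * sqrt (lam i) = sqrt (s i)" for i
  proof -
    have "min 1 (\<theta> / lam i) * lam i = s i"
      using lam_pos[of i] unfolding s_def by (auto simp: min_def field_simps)
    then show ?thesis unfolding \<gamma>_def by (simp add: real_sqrt_mult[symmetric])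
  qed
  have a2: "(a i)\<^sup>2 = 1 - s i / lam i" for i
    using s[of i] lam_pos[of i] unfolding a_def \<gamma>2 by (simp add: field_simps)
  \<comment> \<open>The channel preserves each variance, so \<open>PXs\<close> and
    \<open>PZs\<close> are the same Gaussian law \<open>Q\<close>.\<close>
  have var: "(a i)\<^sup>2 * lam i + s i = lam i" for i
    using lam_pos[of i] unfolding a2 by (simp add: field_simps)
  have Z: "Z = (\<lambda>\<omega>. \<chi> i. a i * X \<omega> $ i + sqrt (s i) * U \<omega> $ i)"
    unfolding Z_def \<gamma>s a_def ..
  have Z_rv [measurable]: "Z \<in> \<Omega> \<rightarrow>\<^sub>M borel" unfolding Z by measurable
  define Q where "Q = density lborel (\<lambda>x. ennreal (gauss_prod (\<lambda>_. 0) lam x))"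
  define G where "G = density lborel (\<lambda>u :: real ^ 'm. ennreal (gauss_prod (\<lambda>_. 0) (\<lambda>_. 1) u))"
  have mvn_G: "mvn_density 0 (mat 1) = gauss_prod (\<lambda>_::'m. 0) (\<lambda>_. 1)"
    unfolding mat_def by (rule mvn_density_diag) simp
  have PXs: "PXs = Q"
    unfolding PXs_def Q_def gaussian_measure_def X_mean X_cov mvn_density_diag[OF lam_pos] ..
  have PZs: "PZs = Q"
    unfolding PZs_def PXs gaussian_measure_def mvn_G \<gamma>s a_def[symmetric] Q_def
    using distr_gaussian_channel_gauss_prod[where s = s and v = lam and a = a] s lam_pos by (simp add: var)
  have Q: "prob_space Q" unfolding Q_def by (rule prob_space_gauss_prod[OF lam_pos])
  define P where "P = distr \<Omega> borel X"
  have P: "prob_space P" unfolding P_def by (rule prob_space_distr) measurable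
  have sP: "sets P = sets borel" by (simp add: P_def)

  \<comment> \<open>Second moments and the linear estimator\<close>
  have X2: "(\<integral>\<omega>. (X \<omega> $ i)\<^sup>2 \<partial>\<Omega>) = lam i" for i
    using arg_cong[OF X_cov, of "\<lambda>A. A $ i $ i"] by (simp add: cov_matrix_def X_mean power2_eq_square)
  have X1_int: "integrable \<Omega> (\<lambda>\<omega>. X \<omega> $ i)" for i
    by (rule square_integrable_imp_integrable[OF _ X_sq]) measurable
  have X1: "(\<integral>\<omega>. X \<omega> $ i \<partial>\<Omega>) = 0" for i
    using integral_bounded_linear[OF bounded_linear_vec_nth X_int, of i] X_mean
    by (simp add: mean_vec_def)
  have mom: "(\<integral>\<^sup>+ x. ennreal ((x $ i)\<^sup>2) \<partial>P) = ennreal (lam i)" for i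
    unfolding P_def by (subst nn_integral_distr) (auto simp: nn_integral_eq_integral[OF X_sq] X2)
  have dU: "distr \<Omega> borel U = G"
  proof -
    have "distr \<Omega> borel U = distr \<Omega> lborel U" by (rule distr_cong) auto
    then show ?thesis using distributed_distr_eq_density[OF U_distr] by (simp add: G_def mvn_G)
  qed
  have U2_nn: "(\<integral>\<^sup>+ \<omega>. ennreal ((U \<omega> $ i)\<^sup>2) \<partial>\<Omega>) = ennreal 1" for i
  proof -
    have "(\<integral>\<^sup>+ \<omega>. ennreal ((U \<omega> $ i)\<^sup>2) \<partial>\<Omega>) = (\<integral>\<^sup>+ u. ennreal ((u $ i)\<^sup>2) \<partial>distr \<Omega> borel U)"
      by (subst nn_integral_distr) auto
    also have "\<dots> = ennreal 1"
      unfolding dU G_def by (rule second_moment_gauss_prod_measure) simp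
    finally show ?thesis .
  qed
  have U2_int: "integrable \<Omega> (\<lambda>\<omega>. (U \<omega> $ i)\<^sup>2)" for i
    by (rule integrableI_nn_integral_finite[OF _ _ U2_nn]) auto
  have U2: "(\<integral>\<omega>. (U \<omega> $ i)\<^sup>2 \<partial>\<Omega>) = 1" for i
    using U2_nn[of i] by (subst (asm) nn_integral_eq_integral[OF U2_int]) auto
  have U1_int: "integrable \<Omega> (\<lambda>\<omega>. U \<omega> $ i)" for i
    by (rule square_integrable_imp_integrable[OF _ U2_int]) measurable
  have ind: "indep_var borel (\<lambda>\<omega>. X \<omega> $ i) borel (\<lambda>\<omega>. U \<omega> $ i)" for i
    using indep_var_compose[OF U_indep, of "\<lambda>x. x $ i" borel "\<lambda>x. x $ i" borel]
    by (simp add: comp_def)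
  have XU_int: "integrable \<Omega> (\<lambda>\<omega>. X \<omega> $ i * U \<omega> $ i)" for i
    by (rule indep_var_integrable[OF ind X1_int U1_int])
  have XU: "(\<integral>\<omega>. X \<omega> $ i * U \<omega> $ i \<partial>\<Omega>) = 0" for i
    using indep_var_lebesgue_integral[OF ind X1_int U1_int] by (simp add: X1)
  have Z2_eq: "(Z \<omega> $ i)\<^sup>2 = (a i)\<^sup>2 * (X \<omega> $ i)\<^sup>2 + 2 * a i * sqrt (s i) * (X \<omega> $ i * U \<omega> $ i)
      + s i * (U \<omega> $ i)\<^sup>2" for \<omega> i
    using s(1)[of i] unfolding Z by (simp add: power2_sum power_mult_distrib less_imp_le algebra_simps)
  have Z2_int: "integrable \<Omega> (\<lambda>\<omega>. (Z \<omega> $ i)\<^sup>2)" for i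
    unfolding Z2_eq using X_sq XU_int U2_int by auto
  have Z2: "(\<integral>\<omega>. (Z \<omega> $ i)\<^sup>2 \<partial>\<Omega>) = lam i" for i
    unfolding Z2_eq using X_sq XU_int U2_int by (simp add: X2 XU U2 var)
  \<comment> \<open>\<open>a i * Z \<omega> $ i\<close> is the linear estimate of
    \<open>X \<omega> $ i\<close>. Since \<open>X\<close> and \<open>U\<close> are uncorrelated
    coordinatewise, its mean square error is \<open>lam i - (a i)^2 * lam i = s i\<close>.\<close>
  have d_eq: "(X \<omega> $ i - a i * Z \<omega> $ i)\<^sup>2 = (X \<omega> $ i)\<^sup>2 + (a i)\<^sup>2 * (Z \<omega> $ i)\<^sup>2
      - (2 * (a i)\<^sup>2 * (X \<omega> $ i)\<^sup>2 + 2 * a i * sqrt (s i) * (X \<omega> $ i * U \<omega> $ i))" for \<omega> i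
    unfolding Z by (simp add: power2_eq_square algebra_simps)
  have d_int: "integrable \<Omega> (\<lambda>\<omega>. (X \<omega> $ i - a i * Z \<omega> $ i)\<^sup>2)" for i
    unfolding d_eq using X_sq Z2_int XU_int by auto
  have d: "(\<integral>\<omega>. (X \<omega> $ i - a i * Z \<omega> $ i)\<^sup>2 \<partial>\<Omega>) = s i" for i
    unfolding d_eq using X_sq Z2_int XU_int var[of i]
    by (simp add: X2 XU Z2) (simp add: algebra_simps)

  \<comment> \<open>Distortion of the conditionally independent copy\<close>
  have Xh_pair: "integrable \<Omega> (\<lambda>\<omega>. f (Xh \<omega>, Z \<omega>))" "(\<integral>\<omega>. f (Xh \<omega>, Z \<omega>) \<partial>\<Omega>) = (\<integral>\<omega>. f (X \<omega>, Z \<omega>) \<partial>\<Omega>)"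
    if [measurable]: "f \<in> borel_measurable (borel \<Otimes>\<^sub>M borel)" and "integrable \<Omega> (\<lambda>\<omega>. f (X \<omega>, Z \<omega>))"
    for f :: "(real ^ 'm) \<times> (real ^ 'm) \<Rightarrow> real"
  proof -
    have "integrable (distr \<Omega> (borel \<Otimes>\<^sub>M borel) (\<lambda>\<omega>. (X \<omega>, Z \<omega>))) f"
      using that by (subst integrable_distr_eq) auto
    then show "integrable \<Omega> (\<lambda>\<omega>. f (Xh \<omega>, Z \<omega>))"
      unfolding Xh_joint[symmetric] by (subst (asm) integrable_distr_eq) auto
    have "(\<integral>\<omega>. f (X \<omega>, Z \<omega>) \<partial>\<Omega>) = (\<integral>w. f w \<partial>distr \<Omega> (borel \<Otimes>\<^sub>M borel) (\<lambda>\<omega>. (X \<omega>, Z \<omega>)))"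
      by (subst integral_distr) auto
    also have "\<dots> = (\<integral>\<omega>. f (Xh \<omega>, Z \<omega>) \<partial>\<Omega>)"
      unfolding Xh_joint[symmetric] by (subst integral_distr) auto
    finally show "(\<integral>\<omega>. f (Xh \<omega>, Z \<omega>) \<partial>\<Omega>) = (\<integral>\<omega>. f (X \<omega>, Z \<omega>) \<partial>\<Omega>)" ..
  qed
  have Xh2_int: "integrable \<Omega> (\<lambda>\<omega>. (Xh \<omega> $ i)\<^sup>2)" for i
    using Xh_pair(1)[of "\<lambda>w. (fst w $ i)\<^sup>2"] X_sq by simp
  have dh_int: "integrable \<Omega> (\<lambda>\<omega>. (Xh \<omega> $ i - a i * Z \<omega> $ i)\<^sup>2)" for i
    using Xh_pair(1)[of "\<lambda>w. (fst w $ i - a i * snd w $ i)\<^sup>2"] d_int by simp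
  have dh: "(\<integral>\<omega>. (Xh \<omega> $ i - a i * Z \<omega> $ i)\<^sup>2 \<partial>\<Omega>) = s i" for i
    using Xh_pair(2)[of "\<lambda>w. (fst w $ i - a i * snd w $ i)\<^sup>2"] d_int d by simp
  have cross: "0 \<le> (\<integral>\<omega>. (X \<omega> $ i - a i * Z \<omega> $ i) * (Xh \<omega> $ i - a i * Z \<omega> $ i) \<partial>\<Omega>)" for i
    using cond_indep_copy_nonneg[OF prob X_rv Xh_rv Z_rv Xh_cond Xh_joint,
        of "\<lambda>x. x $ i" "\<lambda>z. a i * z $ i"] X_sq Xh2_int Z2_int
    by (simp add: power_mult_distrib)
  have cross_int: "integrable \<Omega> (\<lambda>\<omega>. (X \<omega> $ i - a i * Z \<omega> $ i) * (Xh \<omega> $ i - a i * Z \<omega> $ i))" for i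
  proof (rule Bochner_Integration.integrable_bound)
    show "integrable \<Omega> (\<lambda>\<omega>. (X \<omega> $ i - a i * Z \<omega> $ i)\<^sup>2 + (Xh \<omega> $ i - a i * Z \<omega> $ i)\<^sup>2)"
      using d_int dh_int by auto
    have "\<bar>p * q\<bar> \<le> p\<^sup>2 + q\<^sup>2" for p q :: real
    proof -
      have "2 * (\<bar>p\<bar> * \<bar>q\<bar>) \<le> p\<^sup>2 + q\<^sup>2"
        using sum_squares_bound[of "\<bar>p\<bar>" "\<bar>q\<bar>"] by (simp add: mult.assoc)
      moreover have "0 \<le> \<bar>p\<bar> * \<bar>q\<bar>" by simp
      ultimately show ?thesis unfolding abs_mult by linarith
    qed
    then show "AE \<omega> in \<Omega>. norm ((X \<omega> $ i - a i * Z \<omega> $ i) * (Xh \<omega> $ i - a i * Z \<omega> $ i))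
        \<le> norm ((X \<omega> $ i - a i * Z \<omega> $ i)\<^sup>2 + (Xh \<omega> $ i - a i * Z \<omega> $ i)\<^sup>2)"
      by (intro AE_I2) simp
  qed measurable
  \<comment> \<open>Inserting the linear estimate leaves two squares of mean \<open>s i\<close>
    each, the copy inheriting its error from the joint law, and a cross term that by
    \<open>cross\<close> can only lower the sum. Hence each coordinate costs at most
    \<open>2 * s i\<close>.\<close>
  have sq_eq: "(X \<omega> $ i - Xh \<omega> $ i)\<^sup>2 = (X \<omega> $ i - a i * Z \<omega> $ i)\<^sup>2 + (Xh \<omega> $ i - a i * Z \<omega> $ i)\<^sup>2
      - 2 * ((X \<omega> $ i - a i * Z \<omega> $ i) * (Xh \<omega> $ i - a i * Z \<omega> $ i))" for \<omega> i
    by (simp add: power2_eq_square algebra_simps)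
  have "D = (\<Sum>i\<in>UNIV. \<integral>\<omega>. (X \<omega> $ i - Xh \<omega> $ i)\<^sup>2 \<partial>\<Omega>)"
    unfolding D_def norm_power2_vec sq_eq vector_minus_component using d_int dh_int cross_int
    by (intro Bochner_Integration.integral_sum) auto
  also have "\<dots> \<le> (\<Sum>i\<in>UNIV. 2 * s i)"
    unfolding sq_eq using d_int dh_int cross_int cross by (intro sum_mono) (simp add: d dh)
  finally have D: "D / 2 \<le> (\<Sum>i\<in>UNIV. s i)" by (simp add: sum_distrib_left[symmetric])
  have D0: "0 \<le> D / 2" unfolding D_def by simp

  \<comment> \<open>Joint law of input and output\<close>
  define J where "J = density (P \<Otimes>\<^sub>M lborel) (\<lambda>w. ennreal (gauss_prod (\<lambda>i. a i * fst w $ i) s (snd w)))"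
  have J: "J = distr \<Omega> (borel \<Otimes>\<^sub>M borel) (\<lambda>\<omega>. (X \<omega>, Z \<omega>))"
  proof -
    \<comment> \<open>Independence makes the law of \<open>X\<close> and \<open>U\<close> a product,
      and the channel map carries this pair to \<open>X\<close> and \<open>Z\<close>.\<close>
    have "P \<Otimes>\<^sub>M G = distr \<Omega> (borel \<Otimes>\<^sub>M borel) (\<lambda>\<omega>. (X \<omega>, U \<omega>))"
      using U_indep unfolding indep_var_distribution_eq dU P_def by blast
    then have "J = distr (distr \<Omega> (borel \<Otimes>\<^sub>M borel) (\<lambda>\<omega>. (X \<omega>, U \<omega>))) (borel \<Otimes>\<^sub>M borel)
        (\<lambda>(x, u). (x, \<chi> i. a i * x $ i + sqrt (s i) * u $ i))"
      unfolding J_def distr_gaussian_channel[OF P sP s(1), symmetric] G_def by simp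
    also have "\<dots> = distr \<Omega> (borel \<Otimes>\<^sub>M borel) (\<lambda>\<omega>. (X \<omega>, Z \<omega>))"
      by (subst distr_distr) (auto simp: comp_def Z case_prod_unfold)
    finally show ?thesis .
  qed
  have N: "distr J borel snd = distr \<Omega> borel Z"
    unfolding J by (subst distr_distr) (auto simp: comp_def)
  have momN: "(\<integral>\<^sup>+ z. ennreal ((z $ i)\<^sup>2) \<partial>distr J borel snd) = ennreal (lam i)" for i
    unfolding N by (subst nn_integral_distr) (auto simp: nn_integral_eq_integral[OF Z2_int] Z2)
  obtain c where c: "KL2 (distr \<Omega> borel Z) Q = ereal c"
    and MI: "KL2 J (P \<Otimes>\<^sub>M distr \<Omega> borel Z) = ereal ((\<Sum>i\<in>UNIV. log 2 (lam i / s i) / 2) - c)"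
    using gaussian_channel_information[OF P sP s momN[unfolded J_def]]
    unfolding J_def[symmetric] N Q_def[symmetric] by metis

  \<comment> \<open>The two inequalities\<close>
  have "ereal (\<Sum>i\<in>UNIV. log 2 (lam i / s i) / 2) \<le> rate_distortion Q (D / 2) + KL2 Q Q"
    unfolding s_def Q_def
    by (rule rate_distortion_plus_KL2_ge)
      (use prob_space_gauss_prod[OF lam_pos] lam_pos \<theta>_pos second_moment_gauss_prod_measure[OF lam_pos] D
        in \<open>auto simp: s_def\<close>)
  \<comment> \<open>With the Gaussian law as its own reference the divergence vanishes, which leaves
    the converse for the Gaussian source at level \<open>\<theta>\<close>.\<close>
  also have "KL2 Q Q = 0"
    using prob_space_imp_sigma_finite[OF Q] by (rule KL2_self)
  finally have conv: "ereal (\<Sum>i\<in>UNIV. log 2 (lam i / s i) / 2) \<le> rate_distortion Q (D / 2)" by simp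
  \<comment> \<open>The mutual information equals the sum bounded in \<open>conv\<close> minus
    \<open>c\<close>, and subtracting the real number \<open>c\<close> preserves the
    inequality.\<close>
  have "MI \<Omega> X Z \<le> rate_distortion Q (D / 2) - ereal c"
    using MI conv unfolding MI_def J P_def by (cases "rate_distortion Q (D / 2)") auto
  moreover have "rate_distortion Q (D / 2) \<le> rate_distortion P (D / 2) + KL2 P Q"
    unfolding Q_def
  proof (rule rate_distortion_gauss_prod_le_plus_KL2[OF P sP lam_pos mom D0])
    show "D / 2 \<le> (\<Sum>i\<in>UNIV. lam i)"
      using D sum_mono[of UNIV s lam] s(2) by force
  qed
  ultimately show ?thesis
    unfolding PXs PZs c P_def by (auto intro: ereal_minus_mono)
qed

end
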